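(* Let $\mathbb{K}$ be a field and let $\mathcal{A}$ be an essential free arrangement of hyperplanes in $\mathbb{K}^3$. Let $H_1,H_2,H_3\in\mathcal{A}$ be distinct hyperplanes and let $\mathcal{B}:=\mathcal{A}\setminus\{H_1,H_2,H_3\}$. Assume that $\mathcal{B}$ is free too. Then there is a free path from $\mathcal{B}$ to $\mathcal{A}$, i.e. there is a chain $\mathcal{B}=\mathcal{A}_0\subset\mathcal{A}_1\subset\mathcal{A}_2\subset\mathcal{A}_3=\mathcal{A}$ with $|\mathcal{A}_i\setminus\mathcal{A}_{i-1}|=1$ for all $i$ and every $\mathcal{A}_i$ free.
   Context: An arrangement of hyperplanes is a finite set $\mathcal{A}$ of linear hyperplanes in $V=\mathbb{K}^\ell$; it is essential if $\bigcap_{H\in\mathcal{A}}H=\{0\}$. Let $S=\mathbb{K}[x_1,\dots,x_\ell]$, $\mathrm{Der}\,S=\bigoplus_{i} S\,\partial_{x_i}$, and for each $H$ fix a linear form $\alpha_H$ with $H=\ker\alpha_H$. The logarithmic derivation module is $D(\mathcal{A})=\{\theta\in\mathrm{Der}\,S \mid \theta(\alpha_H)\in S\alpha_H \text{ for all } H\in\mathcal{A}\}$. $\mathcal{A}$ is free if $D(\mathcal{A})$ is a free $S$-module. *)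

theory Defs
  imports "HOL-Analysis.Analysis" "HOL-Library.Poly_Mapping"
begin

text \<open>
  The polynomial ring in the variables indexed by \<open>'n\<close>: a polynomial maps each monomial
  (an exponent vector) to its coefficient.  Vectors of \<open>\<bbbK>\<^sup>\<ell>\<close> are elements of \<open>'k ^ 'n\<close>, with
  \<open>\<ell> = CARD('n)\<close>.
\<close>

type_synonym ('k, 'n) mpol = "('n \<Rightarrow>\<^sub>0 nat) \<Rightarrow>\<^sub>0 'k"

definition partial_deriv :: "'n \<Rightarrow> ('k::comm_ring_1, 'n) mpol \<Rightarrow> ('k, 'n) mpol" where
  "partial_deriv i f =
     (\<Sum>m\<in>Poly_Mapping.keys f.
        Poly_Mapping.single (m - Poly_Mapping.single i 1)
          (of_nat (Poly_Mapping.lookup m i) * Poly_Mapping.lookup f m))"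

text \<open>
  \<open>Der S\<close> is the free module on the partial derivatives, so the derivation
  \<open>\<Sum>i. \<theta>\<^sub>i \<partial>\<^sub>i\<close> is represented by its coordinate vector \<open>\<theta>\<close>.
\<close>

type_synonym ('k, 'n) derivation = "('k, 'n) mpol ^ 'n"

definition der_apply ::
    "('k::comm_ring_1, 'n::finite) derivation \<Rightarrow> ('k, 'n) mpol \<Rightarrow> ('k, 'n) mpol" where
  "der_apply \<theta> f = (\<Sum>i\<in>UNIV. \<theta> $ i * partial_deriv i f)"

definition linear_form :: "'k::comm_ring_1 ^ 'n::finite \<Rightarrow> ('k, 'n) mpol" where
  "linear_form a = (\<Sum>i\<in>UNIV. Poly_Mapping.single (Poly_Mapping.single i 1) (a $ i))"

definition linear_form_kernel :: "'k::comm_ring_1 ^ 'n::finite \<Rightarrow> ('k ^ 'n) set" where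
  "linear_form_kernel a = {v. (\<Sum>i\<in>UNIV. a $ i * v $ i) = 0}"

definition hyperplane :: "('k::field ^ 'n::finite) set \<Rightarrow> bool" where
  "hyperplane H \<longleftrightarrow> vec.subspace H \<and> vec.dim H + 1 = CARD('n)"

definition arrangement :: "('k::field ^ 'n::finite) set set \<Rightarrow> bool" where
  "arrangement \<A> \<longleftrightarrow> finite \<A> \<and> (\<forall>H\<in>\<A>. hyperplane H)"

definition essential :: "('k::field ^ 'n::finite) set set \<Rightarrow> bool" where
  "essential \<A> \<longleftrightarrow> \<Inter>\<A> = {0}"

text \<open>A fixed choice of defining form; it is determined by \<open>H\<close> up to a nonzero scalar.\<close>

definition defining_form :: "('k::field ^ 'n::finite) set \<Rightarrow> ('k, 'n) mpol" where
  "defining_form H = linear_form (SOME a. linear_form_kernel a = H)"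

definition log_derivations :: "('k::field ^ 'n::finite) set set \<Rightarrow> ('k, 'n) derivation set" where
  "log_derivations \<A> = {\<theta>. \<forall>H\<in>\<A>. defining_form H dvd der_apply \<theta> (defining_form H)}"

lemma module_vec_scalar_mult:
  "module ((*s) :: 'a::comm_ring_1 \<Rightarrow> 'a ^ 'n \<Rightarrow> 'a ^ 'n)"
  by unfold_locales (simp_all add: vec_eq_iff algebra_simps)

definition free_submodule :: "('a::comm_ring_1 ^ 'n) set \<Rightarrow> bool" where
  "free_submodule M \<longleftrightarrow>
     (\<exists>E. \<not> module.dependent (*s) E \<and> module.span (*s) E = M)"

definition free_arrangement :: "('k::field ^ 'n::finite) set set \<Rightarrow> bool" where
  "free_arrangement \<A> \<longleftrightarrow> free_submodule (log_derivations \<A>)"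

lemma partial_deriv_single:
  "partial_deriv i (Poly_Mapping.single m c) =
     Poly_Mapping.single (m - Poly_Mapping.single i 1) (of_nat (Poly_Mapping.lookup m i) * c)"
  by (cases "c = 0") (simp_all add: partial_deriv_def)

lemma partial_deriv_superset:
  assumes "finite M" "Poly_Mapping.keys f \<subseteq> M"
  shows "partial_deriv i f =
     (\<Sum>m\<in>M. Poly_Mapping.single (m - Poly_Mapping.single i 1)
          (of_nat (Poly_Mapping.lookup m i) * Poly_Mapping.lookup f m))"
  unfolding partial_deriv_def
  by (rule sum.mono_neutral_left) (use assms in \<open>auto simp: in_keys_iff\<close>)

lemma partial_deriv_zero [simp]: "partial_deriv i 0 = 0"
  by (simp add: partial_deriv_def)

lemma partial_deriv_add: "partial_deriv i (f + g) = partial_deriv i f + partial_deriv i g"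
proof -
  let ?M = "Poly_Mapping.keys f \<union> Poly_Mapping.keys g"
  have *: "finite ?M" by simp
  show ?thesis
    using partial_deriv_superset[OF *, of f i] partial_deriv_superset[OF *, of g i]
      partial_deriv_superset[OF *, of "f + g" i] keys_add[of f g]
    by (simp add: lookup_add distrib_left single_add sum.distrib)
qed

lemma partial_deriv_sum: "partial_deriv i (sum f A) = (\<Sum>x\<in>A. partial_deriv i (f x))"
  by (induction A rule: infinite_finite_induct) (simp_all add: partial_deriv_add)

lemma partial_deriv_linear_form:
  "partial_deriv i (linear_form a) = Poly_Mapping.single 0 (a $ i)"
proof -
  have "partial_deriv i (linear_form a) =
      (\<Sum>j\<in>UNIV. if j = i then Poly_Mapping.single 0 (a $ i) else 0)"
    unfolding linear_form_def partial_deriv_sum partial_deriv_single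
    by (intro sum.cong) (auto simp: lookup_single)
  then show ?thesis by simp
qed

end

theory Submission
  imports Defs "HOL-Computational_Algebra.Polynomial"
begin

text \<open>
  A nonempty free arrangement in \<open>\<bbbK>\<^sup>3\<close> has a homogeneous basis of the form \<open>\<theta>\<^sub>E, \<eta>\<^sub>1, \<eta>\<^sub>2\<close> with
  \<open>\<theta>\<^sub>E\<close> the Euler derivation: expand the determinant of an arbitrary basis, which by Saito's
  criterion is the defining polynomial \<open>Q\<close> up to a unit, into homogeneous components; each of them is
  divisible by \<open>Q\<close>, so one of the right degree already is a nonzero constant multiple of \<open>Q\<close>.

  Let \<open>\<A>\<close> be free with exponents \<open>(1, a, b)\<close>, \<open>a \<le> b\<close>, and \<open>H \<in> \<A>\<close>.  If the other members of \<open>\<A>\<close>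
  cut \<open>H\<close> in more than \<open>a\<close> lines, then a combination of \<open>\<eta>\<^sub>1, \<eta>\<^sub>2\<close> is a multiple of \<open>\<theta>\<^sub>E\<close> along \<open>H\<close>, and
  dividing the difference by \<open>\<alpha>\<^sub>H\<close> yields a basis for \<open>\<A> - {H}\<close>.  Dually, let \<open>\<B>\<close> be free with
  exponents \<open>(1, c, d)\<close>, \<open>c \<le> d\<close>, and \<open>H \<notin> \<B>\<close>.  If \<open>\<B>\<close> cuts \<open>H\<close> in at most \<open>d + 1\<close> lines, then
  \<open>\<B> \<union> {H}\<close> is free.  If both fail for some \<open>\<B> \<subseteq> \<A> - {H}\<close>, then \<open>d + 2 \<le> a \<le> b\<close>, whence
  \<open>|\<A>| = 1 + a + b \<ge> |\<B>| + 4\<close>.  So for \<open>|\<A>| \<le> |\<B>| + 3\<close> every \<open>H \<in> \<A> - \<B>\<close> can be deleted from \<open>\<A>\<close>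
  or added to \<open>\<B>\<close>, and two applications of this give the path.
\<close>

section \<open>Ring homomorphisms out of the polynomial ring\<close>

locale ring_homo =
  fixes h :: "'a::comm_ring_1 \<Rightarrow> 'b::comm_ring_1"
  assumes add: "h (x + y) = h x + h y"
    and mult: "h (x * y) = h x * h y"
    and one: "h 1 = 1"
begin

lemma zero: "h 0 = 0"
  using add[of 0 0] by simp

lemma uminus: "h (- x) = - h x"
  using add[of x "- x"] zero by (simp add: eq_neg_iff_add_eq_0 add.commute)

lemma diff: "h (x - y) = h x - h y"
  using add[of x "- y"] uminus by simp

lemma sum: "h (sum f A) = (\<Sum>x\<in>A. h (f x))"
  by (induction A rule: infinite_finite_induct) (simp_all add: zero add)

lemma prod: "h (prod f A) = (\<Prod>x\<in>A. h (f x))"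
  by (induction A rule: infinite_finite_induct) (simp_all add: one mult)

lemma power: "h (x ^ n) = h x ^ n"
  by (induction n) (simp_all add: one mult)

lemma dvd: "x dvd y \<Longrightarrow> h x dvd h y"
  by (auto simp: dvd_def mult)

lemmas hom_simps = add mult one zero uminus diff sum prod power

end

lemma ring_homo_comp: "ring_homo g \<Longrightarrow> ring_homo h \<Longrightarrow> ring_homo (\<lambda>x. h (g x))"
  by (simp add: ring_homo_def)

lemma ring_homo_map_poly:
  assumes "ring_homo h"
  shows "ring_homo (map_poly h)"
proof -
  interpret ring_homo h by fact
  show ?thesis
    by unfold_locales (simp_all add: poly_eq_iff coeff_map_poly coeff_mult hom_simps coeff_1)
qed

section \<open>Constants and variables as generators of the polynomial ring\<close>

definition Const :: "'k::comm_ring_1 \<Rightarrow> ('k, 'n) mpol" where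
  "Const c = Poly_Mapping.single 0 c"

definition Var :: "'n \<Rightarrow> ('k::comm_ring_1, 'n) mpol" where
  "Var l = Poly_Mapping.single (Poly_Mapping.single l 1) 1"

lemma ring_homo_Const: "ring_homo Const"
  by unfold_locales (simp_all add: Const_def single_add mult_single)

interpretation Const: ring_homo Const
  by (rule ring_homo_Const)

lemma Const_eq_0_iff [simp]: "Const c = 0 \<longleftrightarrow> c = 0"
  by (metis Const_def lookup_single_eq lookup_zero single_zero)

lemma Const_0 [simp]: "Const 0 = 0" and Const_1 [simp]: "Const 1 = 1"
  by (simp_all add: Const.zero Const.one)

lemma single_conv_Const_Var:
  fixes c :: "'a::comm_ring_1" and m :: "'n::finite \<Rightarrow>\<^sub>0 nat"
  shows "Poly_Mapping.single m c = Const c * (\<Prod>l\<in>UNIV. Var l ^ Poly_Mapping.lookup m l)"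
proof -
  have pow: "Var l ^ n = Poly_Mapping.single (Poly_Mapping.single l n) (1::'a)" for l :: 'n and n
    by (induction n) (simp_all add: Var_def mult_single single_add[symmetric])
  have prd: "(\<Prod>l\<in>A. Poly_Mapping.single (f l) (1::'a)) = Poly_Mapping.single (sum f A) 1"
    if "finite A" for A :: "'n set" and f :: "'n \<Rightarrow> 'n \<Rightarrow>\<^sub>0 nat"
    using that by (induction A) (simp_all add: mult_single)
  have "(\<Sum>l\<in>UNIV. Poly_Mapping.single l (Poly_Mapping.lookup m l)) = m"
    by (rule poly_mapping_eqI) (simp add: lookup_sum lookup_single when_def)
  then show ?thesis
    by (simp add: pow prd Const_def mult_single)
qed

lemma mpol_sum_singles:
  "(\<Sum>m\<in>Poly_Mapping.keys f. Poly_Mapping.single m (Poly_Mapping.lookup f m)) = f"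
  by (rule poly_mapping_eqI)
    (auto simp: lookup_sum lookup_single when_def in_keys_iff)

lemma mpol_induct [case_names Const Var add mult]:
  fixes f :: "('k::comm_ring_1, 'n::finite) mpol"
  assumes C: "\<And>c. P (Const c)" and V: "\<And>l. P (Var l)"
    and A: "\<And>f g. P f \<Longrightarrow> P g \<Longrightarrow> P (f + g)" and M: "\<And>f g. P f \<Longrightarrow> P g \<Longrightarrow> P (f * g)"
  shows "P f"
proof -
  have 0: "P 0" and 1: "P 1" using C[of 0] C[of 1] by simp_all
  have pow: "P (Var l ^ n)" for l n by (induction n) (auto intro: V M 1)
  have prd: "P (\<Prod>l\<in>A. Var l ^ n l)" for A n
    by (induction A rule: infinite_finite_induct) (auto intro: M 1 pow)
  have "P (\<Sum>m\<in>A. Poly_Mapping.single m (h m))" for A h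
    by (induction A rule: infinite_finite_induct) (auto intro: A M C 0 prd simp: single_conv_Const_Var)
  then have "P (\<Sum>m\<in>Poly_Mapping.keys f. Poly_Mapping.single m (Poly_Mapping.lookup f m))" .
  then show ?thesis by (simp only: mpol_sum_singles)
qed

text \<open>Uniqueness half of the universal property of the polynomial ring;
  \<open>mpol_eval\<close> below is the existence half. Identities between substitutions are thereby
  checked on generators.\<close>

lemma ring_homo_eqI:
  fixes g h :: "('k::comm_ring_1, 'n::finite) mpol \<Rightarrow> 'r::comm_ring_1"
  assumes g: "ring_homo g" and h: "ring_homo h"
    and "\<And>c. g (Const c) = h (Const c)" and "\<And>l. g (Var l) = h (Var l)"
  shows "g f = h f"
proof -
  interpret g: ring_homo g by fact
  interpret h: ring_homo h by fact
  have "g (\<Sum>m\<in>Poly_Mapping.keys f. Poly_Mapping.single m (Poly_Mapping.lookup f m)) =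
      h (\<Sum>m\<in>Poly_Mapping.keys f. Poly_Mapping.single m (Poly_Mapping.lookup f m))"
    by (simp add: single_conv_Const_Var g.hom_simps h.hom_simps assms(3,4))
  then show ?thesis by (simp add: mpol_sum_singles)
qed

definition mpol_eval ::
    "('k::comm_ring_1 \<Rightarrow> 'r::comm_ring_1) \<Rightarrow> ('n::finite \<Rightarrow> 'r) \<Rightarrow> ('k, 'n) mpol \<Rightarrow> 'r" where
  "mpol_eval c v f =
     (\<Sum>m\<in>Poly_Mapping.keys f.
        c (Poly_Mapping.lookup f m) * (\<Prod>l\<in>UNIV. v l ^ Poly_Mapping.lookup m l))"

context
  fixes c :: "'k::comm_ring_1 \<Rightarrow> 'r::comm_ring_1" and v :: "'n::finite \<Rightarrow> 'r"
  assumes c: "ring_homo c"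
begin

interpretation c: ring_homo c by (rule c)

lemma mpol_eval_superset:
  assumes "finite M" "Poly_Mapping.keys f \<subseteq> M"
  shows "mpol_eval c v f =
    (\<Sum>m\<in>M. c (Poly_Mapping.lookup f m) * (\<Prod>l\<in>UNIV. v l ^ Poly_Mapping.lookup m l))"
  unfolding mpol_eval_def
  by (rule sum.mono_neutral_left) (use assms in \<open>auto simp: in_keys_iff c.zero\<close>)

lemma mpol_eval_single:
  "mpol_eval c v (Poly_Mapping.single m a) =
    c a * (\<Prod>l\<in>UNIV. v l ^ Poly_Mapping.lookup m l)"
  using mpol_eval_superset[of "{m}" "Poly_Mapping.single m a"] by simp

lemma mpol_eval_add: "mpol_eval c v (f + g) = mpol_eval c v f + mpol_eval c v g"
proof -
  let ?M = "Poly_Mapping.keys f \<union> Poly_Mapping.keys g"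
  have *: "finite ?M" by simp
  show ?thesis
    using mpol_eval_superset[OF *, of f] mpol_eval_superset[OF *, of g]
      mpol_eval_superset[OF *, of "f + g"] keys_add[of f g]
    by (simp add: lookup_add c.add distrib_right sum.distrib)
qed

lemma mpol_eval_sum: "mpol_eval c v (sum f A) = (\<Sum>x\<in>A. mpol_eval c v (f x))"
  by (induction A rule: infinite_finite_induct)
    (simp_all add: mpol_eval_add, simp_all add: mpol_eval_def)

lemma mpol_eval_mult: "mpol_eval c v (f * g) = mpol_eval c v f * mpol_eval c v g"
proof -
  have *: "mpol_eval c v (Poly_Mapping.single m a * Poly_Mapping.single k b) =
      mpol_eval c v (Poly_Mapping.single m a) * mpol_eval c v (Poly_Mapping.single k b)"
    for m k a b
    by (simp add: mult_single mpol_eval_single c.mult lookup_add power_add prod.distrib mult_ac)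
  have "mpol_eval c v
     ((\<Sum>m\<in>Poly_Mapping.keys f. Poly_Mapping.single m (Poly_Mapping.lookup f m)) *
      (\<Sum>m\<in>Poly_Mapping.keys g. Poly_Mapping.single m (Poly_Mapping.lookup g m))) =
     mpol_eval c v (\<Sum>m\<in>Poly_Mapping.keys f. Poly_Mapping.single m (Poly_Mapping.lookup f m)) *
     mpol_eval c v (\<Sum>m\<in>Poly_Mapping.keys g. Poly_Mapping.single m (Poly_Mapping.lookup g m))"
    unfolding sum_product mpol_eval_sum * ..
  then show ?thesis by (simp only: mpol_sum_singles)
qed

lemma ring_homo_mpol_eval: "ring_homo (mpol_eval c v)"
proof
  show "mpol_eval c v 1 = 1"
    using mpol_eval_single[of 0 1] by (simp add: c.one)
qed (simp_all add: mpol_eval_add mpol_eval_mult)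

lemma mpol_eval_Const: "mpol_eval c v (Const a) = c a"
  by (simp add: Const_def mpol_eval_single)

lemma mpol_eval_Var: "mpol_eval c v (Var l) = v l"
proof -
  have "(\<Prod>k\<in>UNIV. v k ^ Poly_Mapping.lookup (Poly_Mapping.single l (1::nat)) k) =
      (\<Prod>k\<in>UNIV. if k = l then v l else 1)"
    by (intro prod.cong) (auto simp: lookup_single)
  then show ?thesis by (simp add: Var_def mpol_eval_single c.one)
qed

end

section \<open>Homogeneous polynomials\<close>

text \<open>
  Substituting \<open>t x\<^sub>l\<close> for each \<open>x\<^sub>l\<close>; the coefficient of \<open>t\<^sup>d\<close> is the homogeneous component of
  degree \<open>d\<close>.
\<close>

definition grade :: "('k::comm_ring_1, 'n::finite) mpol \<Rightarrow> ('k, 'n) mpol poly" where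
  "grade = mpol_eval (\<lambda>c. [:Const c:]) (\<lambda>l. monom (Var l) 1)"

text \<open>The identity f(tx) = t^d f(x) in the indeterminate t. Products are then handled by
  multiplicativity of \<open>grade\<close>, and 0 is homogeneous of every degree.\<close>

definition homogeneous :: "nat \<Rightarrow> ('k::comm_ring_1, 'n::finite) mpol \<Rightarrow> bool" where
  "homogeneous d f \<longleftrightarrow> grade f = monom f d"

lemma ring_homo_const_poly: "ring_homo (\<lambda>c. [:Const c:])"
  by unfold_locales (simp_all add: Const.hom_simps)

lemma ring_homo_grade: "ring_homo grade"
  unfolding grade_def by (intro ring_homo_mpol_eval ring_homo_const_poly)

interpretation grade: ring_homo grade
  by (rule ring_homo_grade)

lemma grade_Const [simp]: "grade (Const c) = [:Const c:]"
  unfolding grade_def by (intro mpol_eval_Const ring_homo_const_poly)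

lemma grade_Var [simp]: "grade (Var l) = monom (Var l) 1"
  unfolding grade_def by (intro mpol_eval_Var ring_homo_const_poly)

lemma ring_homo_poly_eval: "ring_homo (\<lambda>p. poly p x)"
  by unfold_locales simp_all

lemma poly_grade_1 [simp]: "poly (grade f) 1 = f"
  by (rule ring_homo_eqI[OF ring_homo_comp[OF ring_homo_grade ring_homo_poly_eval]])
    (unfold_locales, simp_all add: poly_monom)

lemma poly_grade_0:
  fixes f :: "('a::comm_ring_1, 'b::finite) mpol"
  shows "poly (grade f) 0 = Const (mpol_eval (\<lambda>c. c) (\<lambda>_. 0) f)"
proof -
  have "ring_homo (\<lambda>c::'a. c)" by unfold_locales simp_all
  note * = ring_homo_mpol_eval[OF this] mpol_eval_Const[OF this] mpol_eval_Var[OF this]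
  show ?thesis
    by (rule ring_homo_eqI[OF ring_homo_comp[OF ring_homo_grade ring_homo_poly_eval]
          ring_homo_comp[OF *(1) ring_homo_Const]])
      (simp_all add: * poly_monom)
qed

lemma homogeneous_Const [simp]: "homogeneous 0 (Const c)"
  by (simp add: homogeneous_def monom_0)

lemma homogeneous_1 [simp]: "homogeneous 0 1"
  by (simp add: homogeneous_def grade.one monom_0 one_pCons)

lemma homogeneous_0 [simp]: "homogeneous d 0"
  by (simp add: homogeneous_def grade.zero)

lemma homogeneous_Var [simp]: "homogeneous 1 (Var l)" "homogeneous (Suc 0) (Var l)"
  by (simp_all add: homogeneous_def)

lemma homogeneous_add: "homogeneous d f \<Longrightarrow> homogeneous d g \<Longrightarrow> homogeneous d (f + g)"
  by (simp add: homogeneous_def grade.add add_monom)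

lemma homogeneous_diff: "homogeneous d f \<Longrightarrow> homogeneous d g \<Longrightarrow> homogeneous d (f - g)"
  by (simp add: homogeneous_def grade.diff diff_monom)

lemma homogeneous_sum:
  "(\<And>x. x \<in> A \<Longrightarrow> homogeneous d (f x)) \<Longrightarrow> homogeneous d (sum f A)"
  by (induction A rule: infinite_finite_induct) (auto intro: homogeneous_add)

lemma homogeneous_mult: "homogeneous d f \<Longrightarrow> homogeneous e g \<Longrightarrow> homogeneous (d + e) (f * g)"
  by (simp add: homogeneous_def grade.mult mult_monom)

lemma homogeneous_Const_mult: "homogeneous d f \<Longrightarrow> homogeneous d (Const c * f)"
  using homogeneous_mult[OF homogeneous_Const] by fastforce

lemma homogeneous_prod:
  "(\<And>x. x \<in> A \<Longrightarrow> homogeneous (d x) (f x)) \<Longrightarrow> homogeneous (sum d A) (prod f A)"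
  by (induction A rule: infinite_finite_induct) (auto intro: homogeneous_mult)

text \<open>By linearity only monomials matter; their \<open>grade\<close> is a single power of t,
  so its coefficient is the monomial itself or 0.\<close>

lemma homogeneous_coeff_grade:
  fixes f :: "('a::comm_ring_1, 'b::finite) mpol"
  shows "homogeneous d (coeff (grade f) d)"
proof -
  have "homogeneous d (coeff (grade (Poly_Mapping.single m (c::'a))) d)" for m :: "'b \<Rightarrow>\<^sub>0 nat" and c
  proof -
    have "homogeneous (0 + (\<Sum>l\<in>UNIV. 1 * Poly_Mapping.lookup m l)) (Poly_Mapping.single m c)"
    proof -
      have "homogeneous (1 * n) (Var l ^ n :: ('a, 'b) mpol)" for l n
        by (induction n) (auto dest: homogeneous_mult[OF homogeneous_Var(1)])
      then show ?thesis
        unfolding single_conv_Const_Var by (intro homogeneous_mult homogeneous_prod) auto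
    qed
    then show ?thesis by (simp add: homogeneous_def) (simp add: grade.zero)
  qed
  then have "homogeneous d
      (coeff (grade (\<Sum>m\<in>Poly_Mapping.keys f. Poly_Mapping.single m (Poly_Mapping.lookup f m))) d)"
    by (simp only: grade.sum coeff_sum homogeneous_sum)
  then show ?thesis by (simp only: mpol_sum_singles)
qed

text \<open>The quotient q has a \<open>grade\<close> of degree d - e in t. If that degree is 0, the
  values at t = 1 and t = 0 agree; these are q and its constant term.\<close>

lemma homogeneous_dvd_cases:
  fixes f g :: "('k::idom, 'n::{finite,linorder}) mpol"
  assumes f: "homogeneous d f" and g: "homogeneous e g" and "g dvd f" and "f \<noteq> 0"
  shows "e \<le> d" and "d \<le> e \<Longrightarrow> \<exists>c. c \<noteq> 0 \<and> f = Const c * g"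
proof -
  obtain q where q: "f = g * q" using \<open>g dvd f\<close> by (auto simp: dvd_def)
  with \<open>f \<noteq> 0\<close> have nz: "g \<noteq> 0" "q \<noteq> 0" by auto
  have eq: "monom f d = monom g e * grade q"
    using f g by (simp add: homogeneous_def q grade.mult)
  have gq: "grade q \<noteq> 0" using eq \<open>f \<noteq> 0\<close> by auto
  have deg: "d = e + degree (grade q)"
    using arg_cong[OF eq, of degree] gq nz \<open>f \<noteq> 0\<close>
    by (simp add: degree_mult_eq degree_monom_eq)
  show "e \<le> d" using deg by simp
  assume "d \<le> e"
  with deg have "degree (grade q) = 0" by simp
  then obtain a where a: "grade q = [:a:]" by (rule degree_eq_zeroE)
  have "q = Const (mpol_eval (\<lambda>c. c) (\<lambda>_. 0) q)"
    using poly_grade_1[of q] poly_grade_0[of q] a by simp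
  with nz(2) q show "\<exists>c. c \<noteq> 0 \<and> f = Const c * g"
    by (metis Const_0 mult.commute)
qed

section \<open>Products of primes in an integral domain\<close>

lemma prime_elem_dvd_prodD:
  assumes "prime_elem p" "p dvd prod f A"
  shows "\<exists>x\<in>A. p dvd f x"
  using assms
  by (induction A rule: infinite_finite_induct)
    (auto dest: prime_elem_not_unit prime_elem_dvd_multD)

text \<open>The primes are split off one at a time: each divides h because it does not divide r, and
  then cancels on both sides.\<close>

lemma prod_primes_dvd_mult_cancel:
  fixes p :: "'i \<Rightarrow> 'a::idom"
  assumes "finite J" "\<And>j. j \<in> J \<Longrightarrow> prime_elem (p j)" "\<And>j. j \<in> J \<Longrightarrow> \<not> p j dvd r"
    and "prod p J dvd r * h"
  shows "prod p J dvd h"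
  using assms
proof (induction J arbitrary: h rule: finite_induct)
  case (insert j J)
  have "p j dvd r * h" using insert.prems(3) insert.hyps by (auto elim: dvd_mult_left)
  then have "p j dvd h" using insert.prems(1,2)[of j] by (auto dest: prime_elem_dvd_multD)
  then obtain h' where h': "h = p j * h'" by (auto simp: dvd_def)
  have "p j * prod p J dvd p j * (r * h')"
    using insert.prems(3) insert.hyps by (simp add: h' mult.left_commute)
  then have "prod p J dvd r * h'" using prime_elem_not_zeroI[OF insert.prems(1)[of j]] by simp
  then have "prod p J dvd h'" by (rule insert.IH[rotated 2]) (use insert.prems(1,2) in blast)+
  then show ?case using insert.hyps by (simp add: h')
qed simp

text \<open>Primes of one class under \<kappa> may be associated, as happens for hyperplanes with
  the same trace on H. So each class product is assumed to divide g, and the classes are joined by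
  \<open>prod_primes_dvd_mult_cancel\<close>.\<close>

lemma prod_primes_dvd_if_classes_dvd:
  fixes p :: "'i \<Rightarrow> 'a::idom" and \<kappa> :: "'i \<Rightarrow> 'c"
  assumes fin: "finite J" and prime: "\<And>j. j \<in> J \<Longrightarrow> prime_elem (p j)"
    and ndvd: "\<And>i j. i \<in> J \<Longrightarrow> j \<in> J \<Longrightarrow> \<kappa> i \<noteq> \<kappa> j \<Longrightarrow> \<not> p i dvd p j"
    and dvd: "\<And>j. j \<in> J \<Longrightarrow> prod p {l\<in>J. \<kappa> l = \<kappa> j} dvd g"
  shows "prod p J dvd g"
proof -
  have "prod p {l\<in>J. \<kappa> l \<in> C} dvd g" if "finite C" "C \<subseteq> \<kappa> ` J" for C
    using that
  proof (induction C rule: finite_induct)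
    case (insert c C)
    let ?G = "{l\<in>J. \<kappa> l = c}" and ?R = "{l\<in>J. \<kappa> l \<in> C}"
    have "prod p ?R dvd g" using insert.IH insert.prems by blast
    then obtain h where h: "g = prod p ?R * h" ..
    obtain j0 where "j0 \<in> J" "c = \<kappa> j0" using insert.prems by blast
    then have "prod p ?G dvd prod p ?R * h" using dvd[of j0] h by simp
    moreover have "\<not> p j dvd prod p ?R" if j: "j \<in> ?G" for j
    proof
      assume "p j dvd prod p ?R"
      then obtain l where "l \<in> ?R" "p j dvd p l"
        using prime_elem_dvd_prodD[of "p j" p ?R] prime j by blast
      moreover have "\<kappa> j \<noteq> \<kappa> l" using j \<open>l \<in> ?R\<close> insert.hyps(2) by auto
      ultimately show False using j ndvd[of j l] by blast
    qed
    moreover have "prime_elem (p j)" if "j \<in> ?G" for j using prime that by blast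
    moreover have "finite ?G" using fin by simp
    ultimately have "prod p ?G dvd h"
      using prod_primes_dvd_mult_cancel[of ?G p "prod p ?R" h] by blast
    then have "prod p ?R * prod p ?G dvd g" by (simp add: h)
    moreover have "{l\<in>J. \<kappa> l \<in> insert c C} = ?R \<union> ?G" by auto
    moreover have "prod p (?R \<union> ?G) = prod p ?R * prod p ?G"
      by (rule prod.union_disjoint) (use insert.hyps(2) fin in auto)
    ultimately show ?case by simp
  qed simp
  moreover have "{l\<in>J. \<kappa> l \<in> \<kappa> ` J} = J" by auto
  ultimately show ?thesis using fin by (metis finite_imageI order_refl)
qed

lemma prod_primes_dvd:
  fixes p :: "'i \<Rightarrow> 'a::idom"
  assumes "finite J" "\<And>j. j \<in> J \<Longrightarrow> prime_elem (p j)"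
    and "\<And>i j. i \<in> J \<Longrightarrow> j \<in> J \<Longrightarrow> i \<noteq> j \<Longrightarrow> \<not> p i dvd p j" and "\<And>j. j \<in> J \<Longrightarrow> p j dvd g"
  shows "prod p J dvd g"
proof (rule prod_primes_dvd_if_classes_dvd[where \<kappa> = "\<lambda>j. j"])
  fix j assume "j \<in> J"
  moreover from this have "{l\<in>J. l = j} = {j}" by auto
  ultimately show "prod p {l\<in>J. l = j} dvd g" using assms by simp
qed (use assms in auto)

text \<open>Writing the multiple of f as f * g, each prime divides g since it does not divide f, and
  cancels.\<close>

lemma dvd_prod_primes_mult_cancel:
  fixes p :: "'i \<Rightarrow> 'a::idom"
  assumes "finite J" "\<And>j. j \<in> J \<Longrightarrow> prime_elem (p j)" "\<And>j. j \<in> J \<Longrightarrow> \<not> p j dvd f"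
    and "f dvd prod p J * r"
  shows "f dvd r"
  using assms
proof (induction J rule: finite_induct)
  case (insert j J)
  obtain g where g: "p j * (prod p J * r) = f * g"
    using insert.prems(3) insert.hyps by (auto simp: dvd_def mult.assoc)
  then have "p j dvd f * g" by (metis dvd_triv_left)
  with insert.prems(1,2)[of j] have "p j dvd g" by (auto dest: prime_elem_dvd_multD)
  then obtain g' where g': "g = p j * g'" by (auto simp: dvd_def)
  have "p j * (prod p J * r) = p j * (f * g')" using g g' by (simp add: mult.left_commute)
  then have "prod p J * r = f * g'" using prime_elem_not_zeroI[OF insert.prems(1)[of j]] by simp
  then have "f dvd prod p J * r" by simp
  then show ?case by (rule insert.IH[rotated 2]) (use insert.prems(1,2) in blast)+
qed simp

section \<open>Linear forms\<close>

lemma linear_form_conv: "linear_form a = (\<Sum>l\<in>UNIV. Const (a $ l) * Var l)"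
  by (simp add: linear_form_def Const_def Var_def mult_single)

lemma linear_form_add: "linear_form (a + b) = linear_form a + linear_form b"
  by (simp add: linear_form_conv Const.add distrib_right sum.distrib)

lemma linear_form_scale: "linear_form (s *s a) = Const s * linear_form a"
  by (simp add: linear_form_conv Const.mult sum_distrib_left mult.assoc)

lemma linear_form_diff: "linear_form (a - b) = linear_form a - linear_form b"
  by (simp add: linear_form_conv Const.diff left_diff_distrib sum_subtractf)

lemma linear_form_eq_0_iff [simp]:
  fixes a :: "'a::comm_ring_1 ^ 'b::finite"
  shows "linear_form a = 0 \<longleftrightarrow> a = 0"
proof
  assume "linear_form a = 0"
  then have "partial_deriv l (linear_form a) = 0" for l by simp
  then have "Const (a $ l) = (0 :: ('a, 'b) mpol)" for l
    by (simp add: partial_deriv_linear_form Const_def)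
  then show "a = 0" by (simp add: vec_eq_iff)
qed (simp add: linear_form_def)

lemma homogeneous_linear_form [simp]:
  "homogeneous (Suc 0) (linear_form a)" "homogeneous 1 (linear_form a)"
  unfolding linear_form_conv by (auto intro!: homogeneous_sum homogeneous_Const_mult)

text \<open>The representative of b modulo multiples of a whose coordinate i is 0, if
  \<open>a $ i\<close> is nonzero. It describes \<open>eliminate\<close> on linear forms.\<close>

definition reduce :: "'n \<Rightarrow> 'k::field ^ 'n \<Rightarrow> 'k ^ 'n \<Rightarrow> 'k ^ 'n" where
  "reduce i a b = b - (b $ i / a $ i) *s a"

text \<open>Solves \<open>linear_form a = 0\<close> for the variable \<open>i\<close> and substitutes the solution.\<close>

definition eliminate :: "'n \<Rightarrow> 'k::field ^ 'n::finite \<Rightarrow> ('k, 'n) mpol \<Rightarrow> ('k, 'n) mpol" where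
  "eliminate i a =
     mpol_eval Const (\<lambda>l. Var l - (if l = i then Const (1 / a $ i) * linear_form a else 0))"

lemma ring_homo_eliminate: "ring_homo (eliminate i a)"
  unfolding eliminate_def by (intro ring_homo_mpol_eval ring_homo_Const)

interpretation eliminate: ring_homo "eliminate i a" for i a
  by (rule ring_homo_eliminate)

lemma eliminate_Const [simp]: "eliminate i a (Const c) = Const c"
  unfolding eliminate_def by (intro mpol_eval_Const ring_homo_Const)

lemma eliminate_Var:
  "eliminate i a (Var l) = Var l - (if l = i then Const (1 / a $ i) * linear_form a else 0)"
  unfolding eliminate_def by (intro mpol_eval_Var ring_homo_Const)

lemma eliminate_Var_other [simp]: "l \<noteq> i \<Longrightarrow> eliminate i a (Var l) = Var l"
  by (simp add: eliminate_Var)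

lemma eliminate_linear_form: "eliminate i a (linear_form b) = linear_form (reduce i a b)"
proof -
  have "eliminate i a (linear_form b) =
      (\<Sum>l\<in>UNIV. Const (b $ l) * Var l -
        (if l = i then Const (b $ i) * (Const (1 / a $ i) * linear_form a) else 0))"
    unfolding linear_form_conv[of b] eliminate.sum
    by (intro sum.cong) (auto simp: eliminate.mult eliminate_Var right_diff_distrib)
  also have "\<dots> = linear_form b - Const (b $ i / a $ i) * linear_form a"
    by (simp add: sum_subtractf linear_form_conv[of b] mult.assoc[symmetric] Const.mult[symmetric])
  finally show ?thesis by (simp add: reduce_def linear_form_diff linear_form_scale)
qed

text \<open>The substitution changes each variable by a multiple of the form, and congruence modulo
  the form respects sums and products.\<close>

lemma linear_form_dvd_diff_eliminate: "linear_form a dvd f - eliminate i a f"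
proof (induction f rule: mpol_induct)
  case (add f g)
  then show ?case
    using dvd_add[OF add] by (simp add: eliminate.add algebra_simps)
next
  case (mult f g)
  have "f * g - eliminate i a (f * g) =
      (f - eliminate i a f) * g + eliminate i a f * (g - eliminate i a g)"
    by (simp add: eliminate.mult algebra_simps)
  then show ?case using mult by simp
qed (simp_all add: eliminate_Var)

lemma eliminate_self: "a $ i \<noteq> 0 \<Longrightarrow> eliminate i a (linear_form a) = 0"
  by (simp add: eliminate_linear_form reduce_def)

text \<open>The kernel of \<open>eliminate i a\<close> is the ideal of the form, so the substitution
  models the quotient ring inside the polynomial ring itself.\<close>

lemma linear_form_dvd_iff:
  assumes "a $ i \<noteq> 0"
  shows "linear_form a dvd f \<longleftrightarrow> eliminate i a f = 0"
proof
  assume "linear_form a dvd f"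
  then show "eliminate i a f = 0"
    using assms by (auto simp: dvd_def eliminate.mult eliminate_self)
next
  assume "eliminate i a f = 0"
  then show "linear_form a dvd f" using linear_form_dvd_diff_eliminate[of a f i] by simp
qed

lemma eliminate_eliminate:
  assumes "a $ i \<noteq> 0"
  shows "eliminate i a (eliminate i a f) = eliminate i a f"
  using linear_form_dvd_diff_eliminate[of a f i]
  by (simp add: linear_form_dvd_iff[OF assms] eliminate.diff)

text \<open>Variables go to forms of degree 1, so the substitution commutes with
  \<open>grade\<close>; this is checked on generators.\<close>

lemma homogeneous_eliminate:
  assumes "homogeneous d f"
  shows "homogeneous d (eliminate i a f)"
proof -
  have "map_poly (eliminate i a) (grade f) = grade (eliminate i a f)"
  proof (rule ring_homo_eqI[where g = "\<lambda>f. map_poly (eliminate i a) (grade f)"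
        and h = "\<lambda>f. grade (eliminate i a f)"])
    show "ring_homo (\<lambda>f. map_poly (eliminate i a) (grade f))"
      by (rule ring_homo_comp[OF ring_homo_grade ring_homo_map_poly[OF ring_homo_eliminate]])
    show "ring_homo (\<lambda>f. grade (eliminate i a f))"
      by (rule ring_homo_comp[OF ring_homo_eliminate ring_homo_grade])
    show "map_poly (eliminate i a) (grade (Const c)) = grade (eliminate i a (Const c))" for c
      by (simp add: map_poly_pCons eliminate.zero)
    show "map_poly (eliminate i a) (grade (Var l)) = grade (eliminate i a (Var l))" for l
    proof -
      have "homogeneous 1 (eliminate i a (Var l))"
        unfolding eliminate_Var by (auto intro!: homogeneous_diff homogeneous_Const_mult)
      then show ?thesis by (simp add: homogeneous_def map_poly_monom eliminate.zero)
    qed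
  qed
  with assms show ?thesis
    by (simp add: homogeneous_def map_poly_monom eliminate.zero)
qed

text \<open>The form generates the kernel of a homomorphism into an integral domain.\<close>

lemma prime_elem_linear_form:
  fixes a :: "'k::field ^ 'n::{finite,linorder}"
  assumes "a \<noteq> 0"
  shows "prime_elem (linear_form a)"
proof -
  obtain i where i: "a $ i \<noteq> 0" using assms by (auto simp: vec_eq_iff)
  show ?thesis
    by (rule prime_elemI) (use assms in \<open>auto simp: linear_form_dvd_iff[OF i] eliminate.hom_simps\<close>)
qed

lemma reduce_eq_0_iff:
  assumes "a $ i \<noteq> 0"
  shows "reduce i a b = 0 \<longleftrightarrow> (\<exists>s. b = s *s a)"
proof
  assume "reduce i a b = 0"
  then have "b = (b $ i / a $ i) *s a" by (simp add: reduce_def)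
  then show "\<exists>s. b = s *s a" ..
qed (use assms in \<open>auto simp: reduce_def\<close>)

lemma linear_form_dvd_linear_form_iff:
  fixes a b :: "'k::field ^ 'n::finite"
  assumes "a \<noteq> 0"
  shows "linear_form a dvd linear_form b \<longleftrightarrow> (\<exists>s. b = s *s a)"
proof -
  obtain i where i: "a $ i \<noteq> 0" using assms by (auto simp: vec_eq_iff)
  show ?thesis
    by (simp add: linear_form_dvd_iff[where i = i] i eliminate_linear_form reduce_eq_0_iff)
qed

lemma reduce_pivot [simp]: "a $ i \<noteq> 0 \<Longrightarrow> reduce i a b $ i = 0"
  by (simp add: reduce_def)

section \<open>Normal vectors of hyperplanes\<close>

lemma hyperplane_eq_kernel:
  fixes H :: "('k::field ^ 'n::finite) set"
  assumes "hyperplane H"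
  shows "\<exists>a. linear_form_kernel a = H"
proof -
  have sub: "vec.subspace H" and dim: "vec.dim H + 1 = CARD('n)"
    using assms by (auto simp: hyperplane_def)
  obtain B where B: "B \<subseteq> H" "vec.independent B" "H \<subseteq> vec.span B" "card B = vec.dim H"
    by (rule vec.basis_exists)
  have span_B: "vec.span B = H"
    using B sub by (metis vec.span_minimal subset_antisym)
  have "H \<noteq> UNIV" using dim by (auto simp: vec.dim_UNIV card_cart_basis)
  then obtain w where w: "w \<notin> H" by auto
  have ind: "vec.independent (insert w B)"
    using B w span_B by (intro vec.independent_insertI) auto
  have "card (insert w B) = CARD('n)"
    using B w dim vec.finiteI_independent[OF B(2)] by (subst card_insert_disjoint) auto
  then have span_wB: "UNIV \<subseteq> vec.span (insert w B)"
    by (intro vec.card_ge_dim_independent ind) (simp_all add: vec.dim_UNIV card_cart_basis)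
  \<comment> \<open>Any coordinate k serves: the functional vanishing on H and equal to 1 at w is
    realised as an endomorphism with values on axis k, and row k of its matrix is the normal
    vector.\<close>
  obtain k :: 'n where True by simp
  obtain f :: "'k ^ 'n \<Rightarrow> 'k ^ 'n" where lin: "Vector_Spaces.linear (*s) (*s) f"
    and f: "\<forall>x\<in>insert w B. f x = (if x = w then axis k 1 else 0)"
    using vec.linear_independent_extend[OF ind, of "\<lambda>x. if x = w then axis k 1 else 0"] by blast
  interpret f: Vector_Spaces.linear "(*s)" "(*s)" f by (rule lin)
  have fB: "f x = 0" if "x \<in> B" for x
    using f w B that by auto
  have fH: "f x = 0" if "x \<in> H" for x
  proof -
    have "x \<in> vec.span B" using that span_B by simp
    then show ?thesis by (rule f.eq_0_on_span[rotated]) (rule fB)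
  qed
  have fw: "f w = axis k 1" using f by simp
  have ker: "(\<Sum>l\<in>UNIV. (matrix f $ k) $ l * x $ l) = f x $ k" for x
    using matrix_works[OF lin, of x] by (simp add: matrix_vector_mult_def vec_eq_iff)
  have "linear_form_kernel (matrix f $ k) = H"
  proof safe
    fix x assume x: "x \<in> linear_form_kernel (matrix f $ k)"
    obtain s where s: "x - s *s w \<in> H"
      using span_wB span_B by (auto simp: vec.span_insert)
    have "f x = s *s f w" using fH[OF s] by (simp add: f.diff f.scale)
    then have "s = 0" using x by (simp add: linear_form_kernel_def ker fw)
    with s show "x \<in> H" by simp
  qed (simp add: linear_form_kernel_def ker fH)
  then show ?thesis ..
qed

definition normal :: "('k::field ^ 'n::finite) set \<Rightarrow> 'k ^ 'n" where
  "normal H = (SOME a. linear_form_kernel a = H)"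

lemma defining_form_eq: "defining_form H = linear_form (normal H)"
  by (simp add: defining_form_def normal_def)

lemma linear_form_kernel_normal:
  assumes "hyperplane H"
  shows "linear_form_kernel (normal H) = H"
  unfolding normal_def by (rule someI_ex[OF hyperplane_eq_kernel[OF assms]])

lemma mem_hyperplane_iff:
  assumes "hyperplane H"
  shows "v \<in> H \<longleftrightarrow> (\<Sum>l\<in>UNIV. normal H $ l * v $ l) = 0"
  using linear_form_kernel_normal[OF assms] by (auto simp: linear_form_kernel_def)

lemma normal_nonzero:
  fixes H :: "('k::field ^ 'n::finite) set"
  assumes "hyperplane H"
  shows "normal H \<noteq> 0"
proof
  assume "normal H = 0"
  then have "H = UNIV" using linear_form_kernel_normal[OF assms] by (auto simp: linear_form_kernel_def)
  with assms show False by (auto simp: hyperplane_def vec.dim_UNIV card_cart_basis)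
qed

lemma normal_not_parallel:
  assumes "hyperplane H" "hyperplane X" "H \<noteq> X"
  shows "normal X \<noteq> s *s normal H"
proof
  assume eq: "normal X = s *s normal H"
  with normal_nonzero[OF assms(2)] have "s \<noteq> 0" by auto
  have "(\<Sum>l\<in>UNIV. normal X $ l * v $ l) = s * (\<Sum>l\<in>UNIV. normal H $ l * v $ l)" for v
    by (simp add: eq sum_distrib_left mult.assoc)
  with \<open>s \<noteq> 0\<close> have "v \<in> X \<longleftrightarrow> v \<in> H" for v
    using assms by (simp add: mem_hyperplane_iff)
  with assms show False by auto
qed

lemma prime_elem_defining_form:
  fixes H :: "('k::field ^ 'n::{finite,linorder}) set"
  shows "hyperplane H \<Longrightarrow> prime_elem (defining_form H)"
  by (simp add: defining_form_eq prime_elem_linear_form normal_nonzero)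

lemma defining_form_not_dvd:
  assumes "hyperplane H" "hyperplane X" "H \<noteq> X"
  shows "\<not> defining_form H dvd defining_form X"
  using normal_not_parallel[OF assms] normal_nonzero[OF assms(1)]
  by (simp add: defining_form_eq linear_form_dvd_linear_form_iff)

section \<open>Logarithmic derivations\<close>

text \<open>By \<open>der_apply_linear_form\<close>, the value of \<theta> on the linear form with
  coefficients b.\<close>

definition contract :: "'k::comm_ring_1 ^ 'n::finite \<Rightarrow> ('k, 'n) derivation \<Rightarrow> ('k, 'n) mpol" where
  "contract b \<theta> = (\<Sum>l\<in>UNIV. Const (b $ l) * \<theta> $ l)"

definition euler :: "('k::comm_ring_1, 'n::finite) derivation" where
  "euler = (\<chi> l. Var l)"

lemma der_apply_linear_form: "der_apply \<theta> (linear_form b) = contract b \<theta>"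
  by (simp add: der_apply_def contract_def partial_deriv_linear_form Const_def mult.commute)

lemma contract_add: "contract b (\<theta> + \<eta>) = contract b \<theta> + contract b \<eta>"
  by (simp add: contract_def distrib_left sum.distrib)

lemma contract_diff: "contract b (\<theta> - \<eta>) = contract b \<theta> - contract b \<eta>"
  by (simp add: contract_def right_diff_distrib sum_subtractf)

lemma contract_scale: "contract b (f *s \<theta>) = f * contract b \<theta>"
  by (simp add: contract_def sum_distrib_left mult.left_commute)

lemma contract_zero: "contract b 0 = 0"
  by (simp add: contract_def)

lemma contract_add_left: "contract (a + b) \<theta> = contract a \<theta> + contract b \<theta>"
  by (simp add: contract_def Const.add distrib_right sum.distrib)

lemma contract_scale_left: "contract (s *s b) \<theta> = Const s * contract b \<theta>"
  by (simp add: contract_def Const.mult sum_distrib_left mult.assoc)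

lemma contract_euler: "contract b euler = linear_form b"
  by (simp add: contract_def euler_def linear_form_conv)

lemma log_derivations_iff:
  "\<theta> \<in> log_derivations \<A> \<longleftrightarrow> (\<forall>H\<in>\<A>. defining_form H dvd contract (normal H) \<theta>)"
  by (simp add: log_derivations_def defining_form_eq der_apply_linear_form)

interpretation der_module: module "(*s) :: 'a::comm_ring_1 \<Rightarrow> 'a ^ 'n \<Rightarrow> 'a ^ 'n"
  by (rule module_vec_scalar_mult)

lemma subspace_log_derivations: "der_module.subspace (log_derivations \<A>)"
  by (rule der_module.subspaceI)
    (auto simp: log_derivations_iff contract_zero contract_add contract_scale)

lemma euler_log_derivation: "euler \<in> log_derivations \<A>"
  by (simp add: log_derivations_iff contract_euler defining_form_eq)

definition defining_poly :: "('k::field ^ 'n::finite) set set \<Rightarrow> ('k, 'n) mpol" where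
  "defining_poly \<A> = (\<Prod>H\<in>\<A>. defining_form H)"

lemma defining_poly_nonzero:
  fixes \<A> :: "('k::field ^ 'n::{finite,linorder}) set set"
  shows "arrangement \<A> \<Longrightarrow> defining_poly \<A> \<noteq> 0"
  by (auto simp: defining_poly_def arrangement_def defining_form_eq normal_nonzero)

lemma defining_poly_insert:
  "arrangement \<A> \<Longrightarrow> H \<notin> \<A> \<Longrightarrow> defining_poly (insert H \<A>) = defining_form H * defining_poly \<A>"
  by (simp add: defining_poly_def arrangement_def)

lemma homogeneous_defining_poly: "homogeneous (card \<A>) (defining_poly \<A>)"
  using homogeneous_prod[of \<A> "\<lambda>_. 1" defining_form]
  by (simp add: defining_poly_def defining_form_eq)

lemma defining_poly_dvd:
  fixes \<A> :: "('k::field ^ 'n::{finite,linorder}) set set"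
  assumes "arrangement \<A>" and "\<And>H. H \<in> \<A> \<Longrightarrow> defining_form H dvd f"
  shows "defining_poly \<A> dvd f"
  unfolding defining_poly_def using assms
  by (intro prod_primes_dvd) (auto simp: arrangement_def prime_elem_defining_form defining_form_not_dvd)

section \<open>Determinants of triples\<close>

definition det3 :: "'a::comm_ring_1 ^ 3 \<Rightarrow> 'a ^ 3 \<Rightarrow> 'a ^ 3 \<Rightarrow> 'a" where
  "det3 u v w = u $ 1 * (v $ 2 * w $ 3 - v $ 3 * w $ 2) + u $ 2 * (v $ 3 * w $ 1 - v $ 1 * w $ 3)
     + u $ 3 * (v $ 1 * w $ 2 - v $ 2 * w $ 1)"

text \<open>Cyclic index triples let any nonzero coordinate of a normal vector come first without a
  change of sign in \<open>det3\<close>.\<close>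

definition cyclic :: "3 \<Rightarrow> 3 \<Rightarrow> 3 \<Rightarrow> bool" where
  "cyclic i j k \<longleftrightarrow> i = 1 \<and> j = 2 \<and> k = 3 \<or> i = 2 \<and> j = 3 \<and> k = 1 \<or> i = 3 \<and> j = 1 \<and> k = 2"

lemma cyclic_exists: "\<exists>j k. cyclic i j k"
  using exhaust_3[of i] by (auto simp: cyclic_def)

lemma cyclic_distinct:
  assumes "cyclic i j k"
  shows "i \<noteq> j" "j \<noteq> i" "i \<noteq> k" "k \<noteq> i" "j \<noteq> k" "k \<noteq> j"
  using assms by (auto simp: cyclic_def)

lemma sum_cyclic:
  assumes "cyclic i j k"
  shows "sum f UNIV = f i + f j + f k"
  using assms by (auto simp: cyclic_def sum_3 ac_simps)

lemma all_cyclic: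
  assumes "cyclic i j k"
  shows "(\<forall>l. P l) \<longleftrightarrow> P i \<and> P j \<and> P k"
  using assms by (auto simp: cyclic_def forall_3)

lemma pivot_exists:
  fixes H :: "('k::field ^ 3) set"
  assumes "hyperplane H"
  obtains i j k where "normal H $ i \<noteq> 0" "cyclic i j k"
proof -
  obtain i where "normal H $ i \<noteq> 0" using normal_nonzero[OF assms] by (auto simp: vec_eq_iff)
  then show ?thesis using that cyclic_exists by blast
qed

lemma det3_cyclic:
  assumes "cyclic i j k"
  shows "det3 u v w = u $ i * (v $ j * w $ k - v $ k * w $ j) + u $ j * (v $ k * w $ i - v $ i * w $ k)
     + u $ k * (v $ i * w $ j - v $ j * w $ i)"
  using assms by (auto simp: cyclic_def det3_def)

lemma det3_rotate: "det3 u v w = det3 v w u"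
  by (simp add: det3_def algebra_simps)

lemma det3_swap: "det3 u v w = - det3 u w v"
  by (simp add: det3_def algebra_simps)

lemma det3_same [simp]: "det3 u u v = 0" "det3 u v u = 0" "det3 v u u = 0"
  by (simp_all add: det3_def algebra_simps)

lemma det3_add: "det3 (u + u') v w = det3 u v w + det3 u' v w"
  by (simp add: det3_def algebra_simps)

lemma det3_scale: "det3 (s *s u) v w = s * det3 u v w"
  by (simp add: det3_def algebra_simps)

lemma det3_zero: "det3 0 v w = 0"
  by (simp add: det3_def)

lemma det3_cramer: "det3 u v w *s x = det3 x v w *s u + det3 u x w *s v + det3 u v x *s w"
  by (simp add: vec_eq_iff forall_3 det3_def algebra_simps)

text \<open>A column operation: column i, scaled by \<open>a $ i\<close>, receives the multiples of
  the other columns that turn it into the contractions; the right side is the expansion along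
  it.\<close>

lemma det3_contract:
  assumes "cyclic i j k"
  shows "Const (a $ i) * det3 u v w = contract a u * (v $ j * w $ k - v $ k * w $ j)
    + contract a v * (w $ j * u $ k - w $ k * u $ j) + contract a w * (u $ j * v $ k - u $ k * v $ j)"
  by (simp add: contract_def sum_cyclic[OF assms] det3_cyclic[OF assms] algebra_simps)

text \<open>The condition is linear in the first argument, and rotation brings each argument to the
  front in turn.\<close>

lemma det3_dvd_span:
  assumes "u \<in> der_module.span E" "v \<in> der_module.span E" "w \<in> der_module.span E"
    and E: "\<And>u v w. u \<in> E \<Longrightarrow> v \<in> E \<Longrightarrow> w \<in> E \<Longrightarrow> g dvd det3 u v w"
  shows "g dvd det3 u v w"
proof -
  have sub: "der_module.subspace {u. g dvd det3 u v w}" for v w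
    by (rule der_module.subspaceI) (auto simp: det3_zero det3_add det3_scale)
  have *: "g dvd det3 u v w" if "u \<in> der_module.span E" "\<And>u. u \<in> E \<Longrightarrow> g dvd det3 u v w" for u v w
    using der_module.span_minimal[OF _ sub[of v w], of E] that by blast
  have 1: "g dvd det3 u v w" if "u \<in> der_module.span E" "v \<in> E" "w \<in> E" for u v w
    using * that E by blast
  have 2: "g dvd det3 v w u"
    if u: "u \<in> der_module.span E" and v: "v \<in> der_module.span E" and w: "w \<in> E" for u v w
  proof (rule *[OF v])
    show "g dvd det3 v w u" if "v \<in> E" for v
      using 1[OF u that w] unfolding det3_rotate[of u v w] .
  qed
  have "g dvd det3 w u v"
  proof (rule *[OF assms(3)])
    show "g dvd det3 w u v" if "w \<in> E" for w
      using 2[OF assms(1,2) that] unfolding det3_rotate[of v w u] .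
  qed
  then show ?thesis unfolding det3_rotate[of w u v] .
qed

section \<open>Saito's criterion\<close>

lemma is_unit_Const: "c \<noteq> 0 \<Longrightarrow> Const c dvd (1 :: ('k::field, 'n) mpol)"
  by (rule dvdI[where k = "Const (1 / c)"]) (simp add: Const.mult[symmetric])

lemma dvd_unit_mult_cancel:
  fixes x y e :: "'a::comm_semiring_1"
  assumes "e dvd 1" "x dvd e * y"
  shows "x dvd y"
proof -
  obtain e' where e': "1 = e * e'" using assms(1) ..
  have "x dvd e' * (e * y)" using assms(2) by (rule dvd_mult)
  also have "e' * (e * y) = (e * e') * y" by (simp only: mult_ac)
  finally show ?thesis by (simp add: e'[symmetric])
qed

lemma vec_scale_cancel:
  fixes q :: "'a::idom"
  shows "q \<noteq> 0 \<Longrightarrow> q *s x = q *s y \<Longrightarrow> x = y"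
  by (auto simp: vec_eq_iff)

text \<open>In \<open>det3_contract\<close> all three contractions are multiples of the form of H.
  The forms are pairwise non-associated primes, so their product divides as well.\<close>

lemma defining_poly_dvd_det3:
  fixes \<A> :: "('k::field ^ 3) set set"
  assumes A: "arrangement \<A>"
    and D: "u \<in> log_derivations \<A>" "v \<in> log_derivations \<A>" "w \<in> log_derivations \<A>"
  shows "defining_poly \<A> dvd det3 u v w"
proof (rule defining_poly_dvd[OF A])
  fix H assume H: "H \<in> \<A>"
  with A obtain i j k where i: "normal H $ i \<noteq> 0" and c: "cyclic i j k"
    using pivot_exists[of H] by (auto simp: arrangement_def)
  have "defining_form H dvd Const (normal H $ i) * det3 u v w"
    unfolding det3_contract[OF c] using D H by (auto simp: log_derivations_iff)
  then show "defining_form H dvd det3 u v w"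
    by (rule dvd_unit_mult_cancel[OF is_unit_Const[OF i]])
qed

text \<open>Saito's criterion, sufficiency: in Cramer's rule the numerators for a logarithmic
  derivation are divisible by \<open>defining_poly\<close>, which cancels against the determinant up
  to the unit e.\<close>

lemma free_arrangement_if_det3:
  fixes \<A> :: "('k::field ^ 3) set set"
  assumes A: "arrangement \<A>"
    and D: "u \<in> log_derivations \<A>" "v \<in> log_derivations \<A>" "w \<in> log_derivations \<A>"
    and det: "det3 u v w = e * defining_poly \<A>" and e: "e dvd 1"
  shows "free_arrangement \<A>"
proof -
  let ?d = "det3 u v w" and ?Q = "defining_poly \<A>"
  have d0: "?d \<noteq> 0" using det e defining_poly_nonzero[OF A] by auto
  have neq: "u \<noteq> v" "u \<noteq> w" "v \<noteq> w" using d0 by auto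
  have ind: "\<not> der_module.dependent {u, v, w}"
  proof
    assume "der_module.dependent {u, v, w}"
    then obtain c where c: "\<exists>x\<in>{u, v, w}. c x \<noteq> 0" and "(\<Sum>x\<in>{u, v, w}. c x *s x) = 0"
      by (subst (asm) der_module.dependent_finite) auto
    then have "c u *s u + c v *s v + c w *s w = 0" (is "?s = 0")
      using neq by (simp add: add.assoc)
    then have "det3 ?s v w = 0" "det3 ?s w u = 0" "det3 ?s u v = 0" by (simp_all add: det3_zero)
    then have "c u * ?d = 0" "c v * ?d = 0" "c w * ?d = 0"
      using det3_rotate[of u v w] det3_rotate[of w u v] by (simp_all add: det3_add det3_scale)
    with c d0 show False by auto
  qed
  have "x \<in> der_module.span {u, v, w}" if x: "x \<in> log_derivations \<A>" for x
  proof -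
    obtain e' where e': "e * e' = 1" using e by (auto simp: dvd_def)
    obtain f g h where fgh: "det3 x v w = ?Q * f" "det3 u x w = ?Q * g" "det3 u v x = ?Q * h"
      using defining_poly_dvd_det3[OF A] x D by (metis dvdE)
    have "?Q *s (e *s x) = ?Q *s (f *s u + g *s v + h *s w)"
      using det3_cramer[of u v w x] by (simp add: det fgh vec_eq_iff algebra_simps)
    then have "e *s x = f *s u + g *s v + h *s w"
      by (rule vec_scale_cancel[OF defining_poly_nonzero[OF A]])
    then have "e' *s (e *s x) = e' *s (f *s u + g *s v + h *s w)" by simp
    then have "x = e' *s (f *s u + g *s v + h *s w)" using e' by (simp add: mult.commute)
    moreover have "\<dots> \<in> der_module.span {u, v, w}"
      by (intro der_module.span_scale der_module.span_add) (auto intro: der_module.span_base)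
    ultimately show ?thesis by simp
  qed
  moreover have "der_module.span {u, v, w} \<subseteq> log_derivations \<A>"
    using D by (intro der_module.span_minimal subspace_log_derivations) auto
  ultimately have "der_module.span {u, v, w} = log_derivations \<A>" by auto
  with ind show ?thesis unfolding free_arrangement_def free_submodule_def by blast
qed

text \<open>A constant vector field parallel to the hyperplane with normal a; multiplied by the
  forms of the other hyperplanes it becomes logarithmic.\<close>

definition tangent :: "'n \<Rightarrow> 'n \<Rightarrow> 'k::comm_ring_1 ^ 'n::finite \<Rightarrow> ('k, 'n) derivation" where
  "tangent i j a = Const (a $ i) *s axis j 1 - Const (a $ j) *s axis i 1"

lemma contract_axis: "contract a (axis i f) = Const (a $ i) * f"
  by (simp add: contract_def axis_def if_distrib cong: if_cong)

lemma contract_tangent: "contract a (tangent i j a) = 0"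
  by (simp add: tangent_def contract_diff contract_scale contract_axis)

lemma det3_tangent:
  assumes "cyclic i j k"
  shows "det3 u (tangent i j a) (tangent i k a) = Const (a $ i) * contract a u"
  using cyclic_distinct[OF assms]
  by (simp add: det3_cyclic[OF assms] contract_def sum_cyclic[OF assms] tangent_def axis_def algebra_simps)

lemma free_arrangement_singleton:
  fixes H :: "('k::field ^ 3) set"
  assumes H: "hyperplane H"
  shows "free_arrangement {H}"
proof -
  obtain i j k where i: "normal H $ i \<noteq> 0" and c: "cyclic i j k" using pivot_exists[OF H] .
  show ?thesis
  proof (rule free_arrangement_if_det3)
    show "arrangement {H}" using H by (simp add: arrangement_def)
    show "det3 euler (tangent i j (normal H)) (tangent i k (normal H)) =
        Const (normal H $ i) * defining_poly {H}"
      by (simp add: det3_tangent[OF c] contract_euler defining_poly_def defining_form_eq)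
  qed (use i in \<open>auto simp: contract_euler defining_form_eq is_unit_Const log_derivations_iff contract_tangent\<close>)
qed

section \<open>Determinants of arbitrary bases: Saito's criterion, necessity\<close>

lemma arrangement_subset: "arrangement \<A> \<Longrightarrow> \<B> \<subseteq> \<A> \<Longrightarrow> arrangement \<B>"
  by (auto simp: arrangement_def intro: finite_subset)

lemma defining_poly_scale_log_derivation:
  assumes "arrangement \<A>"
  shows "defining_poly \<A> *s \<theta> \<in> log_derivations \<A>"
proof -
  have "defining_form H dvd defining_poly \<A>" if "H \<in> \<A>" for H
    using that assms unfolding defining_poly_def arrangement_def by (intro dvd_prodI) auto
  then show ?thesis by (simp add: log_derivations_iff contract_scale)
qed

text \<open>Some three basis elements have nonzero determinant, because the derivations
  \<open>?Q *s ?a i\<close> do; a fourth basis element would satisfy Cramer's relation with them. So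
  every determinant of logarithmic derivations is a multiple of that of the basis.\<close>

lemma free_arrangement_basis:
  fixes \<A> :: "('k::field ^ 3) set set"
  assumes A: "arrangement \<A>" and free: "free_arrangement \<A>"
  obtains u v w where "u \<in> log_derivations \<A>" "v \<in> log_derivations \<A>" "w \<in> log_derivations \<A>"
    "det3 u v w \<noteq> 0"
    "\<forall>x\<in>log_derivations \<A>. \<forall>y\<in>log_derivations \<A>. \<forall>z\<in>log_derivations \<A>.
      det3 u v w dvd det3 x y z"
proof -
  obtain E where ind: "\<not> der_module.dependent E" and span: "der_module.span E = log_derivations \<A>"
    using free by (auto simp: free_arrangement_def free_submodule_def)
  let ?Q = "defining_poly \<A>" and ?a = "\<lambda>i. axis i 1 :: ('k, 3) derivation"
  have "\<exists>u\<in>E. \<exists>v\<in>E. \<exists>w\<in>E. det3 u v w \<noteq> 0"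
  proof (rule ccontr)
    assume "\<not> ?thesis"
    \<comment> \<open>Vanishing is phrased as divisibility by 0 so that \<open>det3_dvd_span\<close>
      carries it over to the whole module.\<close>
    then have *: "0 dvd det3 u v w" if "u \<in> E" "v \<in> E" "w \<in> E" for u v w
      using that by simp
    have Qa: "?Q *s ?a i \<in> der_module.span E" for i
      unfolding span by (rule defining_poly_scale_log_derivation[OF A])
    have "0 dvd det3 (?Q *s ?a 1) (?Q *s ?a 2) (?Q *s ?a 3)"
      by (rule det3_dvd_span[OF Qa Qa Qa *])
    then show False using defining_poly_nonzero[OF A] by (simp add: det3_def axis_def)
  qed
  then obtain u v w where E: "u \<in> E" "v \<in> E" "w \<in> E" and d0: "det3 u v w \<noteq> 0" by blast
  have neq: "u \<noteq> v" "u \<noteq> w" "v \<noteq> w" using d0 by auto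
  have E_eq: "x = u \<or> x = v \<or> x = w" if x: "x \<in> E" for x
  proof (rule ccontr)
    assume new: "\<not> ?thesis"
    let ?c = "\<lambda>y. if y = x then - det3 u v w else if y = u then det3 x v w
      else if y = v then det3 u x w else det3 u v x"
    have "(\<Sum>y\<in>{x, u, v, w}. ?c y *s y) = 0"
      using new neq det3_cramer[of u v w x] by (auto simp: add.assoc)
    then have "?c x = 0"
      by (rule der_module.independentD[OF ind, rotated 2]) (use x E in auto)
    with d0 show False by simp
  qed
  have "det3 u v w dvd det3 x y z" if "x \<in> E" "y \<in> E" "z \<in> E" for x y z
    using E_eq[OF that(1)] E_eq[OF that(2)] E_eq[OF that(3)]
      det3_rotate[of u v w] det3_rotate[of w u v] det3_swap[of u v w] det3_swap[of v w u] det3_swap[of w u v]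
    by (elim disjE) simp_all
  then have dvd: "det3 u v w dvd det3 x y z"
    if "x \<in> log_derivations \<A>" "y \<in> log_derivations \<A>" "z \<in> log_derivations \<A>" for x y z
    using det3_dvd_span[of x E y z] that by (simp add: span)
  have "u \<in> log_derivations \<A>" "v \<in> log_derivations \<A>" "w \<in> log_derivations \<A>"
    using E der_module.span_base[of _ E] by (simp_all add: span)
  moreover have "\<forall>x\<in>log_derivations \<A>. \<forall>y\<in>log_derivations \<A>. \<forall>z\<in>log_derivations \<A>.
      det3 u v w dvd det3 x y z"
    by (intro ballI dvd)
  ultimately show ?thesis by (rule that[OF _ _ _ d0])
qed

text \<open>The determinant is Q f, with Q the defining polynomial. Testing it on Q times a
  coordinate derivation and on two tangent fields times \<open>?\<pi> H\<close> shows that f divides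
  the square of \<open>?\<pi> H\<close>, for every H. Hence no defining form divides f, and
  cancelling the primes of one such square leaves f a unit.\<close>

lemma free_arrangement_det3:
  fixes \<A> :: "('k::field ^ 3) set set"
  assumes A: "arrangement \<A>" and ne: "\<A> \<noteq> {}" and free: "free_arrangement \<A>"
  obtains u v w where "u \<in> log_derivations \<A>" "v \<in> log_derivations \<A>" "w \<in> log_derivations \<A>"
    "det3 u v w = defining_poly \<A>"
proof -
  obtain u v w where D: "u \<in> log_derivations \<A>" "v \<in> log_derivations \<A>" "w \<in> log_derivations \<A>"
    and d0: "det3 u v w \<noteq> 0"
    and dvd: "\<forall>x\<in>log_derivations \<A>. \<forall>y\<in>log_derivations \<A>. \<forall>z\<in>log_derivations \<A>.
      det3 u v w dvd det3 x y z"
    by (rule free_arrangement_basis[OF A free])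
  obtain f where f: "det3 u v w = defining_poly \<A> * f"
    using defining_poly_dvd_det3[OF A D] by (auto simp: dvd_def)
  let ?\<pi> = "\<lambda>H. defining_poly (\<A> - {H})"
  have pi: "f dvd ?\<pi> H * ?\<pi> H" if H: "H \<in> \<A>" for H
  proof -
    have hyp: "hyperplane H" and A': "arrangement (\<A> - {H})"
      using H A by (auto simp: arrangement_def)
    obtain i j k where i: "normal H $ i \<noteq> 0" and c: "cyclic i j k" using pivot_exists[OF hyp] .
    let ?a = "normal H"
    have Q: "defining_poly \<A> = defining_form H * ?\<pi> H"
      using defining_poly_insert[OF A', of H] H by (simp add: insert_absorb)
    have mem: "?\<pi> H *s tangent i l ?a \<in> log_derivations \<A>" for l
    proof -
      have "?\<pi> H *s tangent i l ?a \<in> log_derivations (\<A> - {H})"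
        by (rule defining_poly_scale_log_derivation[OF A'])
      then show ?thesis by (auto simp: log_derivations_iff contract_scale contract_tangent)
    qed
    have "det3 u v w dvd
        det3 (defining_poly \<A> *s axis i 1) (?\<pi> H *s tangent i j ?a) (?\<pi> H *s tangent i k ?a)"
      by (intro dvd[rule_format] mem defining_poly_scale_log_derivation[OF A])
    also have "\<dots> = ?\<pi> H * ?\<pi> H * det3 (defining_poly \<A> *s axis i 1) (tangent i j ?a) (tangent i k ?a)"
      by (simp add: det3_def algebra_simps)
    also have "\<dots> = defining_poly \<A> * (Const (?a $ i) * (Const (?a $ i) * (?\<pi> H * ?\<pi> H)))"
      by (simp add: det3_tangent[OF c] contract_scale contract_axis mult_ac)
    finally have "f dvd Const (?a $ i) * (Const (?a $ i) * (?\<pi> H * ?\<pi> H))"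
      using defining_poly_nonzero[OF A] by (simp add: f)
    then show ?thesis
      by (rule dvd_unit_mult_cancel[OF is_unit_Const[OF i] dvd_unit_mult_cancel[OF is_unit_Const[OF i]]])
  qed
  have unit: "f dvd 1"
  proof -
    obtain H where H: "H \<in> \<A>" using ne by auto
    have ndvd: "\<not> defining_form X dvd f" if X: "X \<in> \<A>" for X
    proof
      assume "defining_form X dvd f"
      then have "defining_form X dvd ?\<pi> X * ?\<pi> X" using pi[OF X] by (rule dvd_trans)
      moreover have prime: "prime_elem (defining_form X)"
        using X A by (simp add: arrangement_def prime_elem_defining_form)
      ultimately have "defining_form X dvd ?\<pi> X" by (auto dest: prime_elem_dvd_multD)
      then obtain Y where "Y \<in> \<A> - {X}" "defining_form X dvd defining_form Y"
        unfolding defining_poly_def using prime_elem_dvd_prodD[OF prime] by blast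
      then show False using defining_form_not_dvd[of X Y] X A by (auto simp: arrangement_def)
    qed
    have *: "f dvd r" if "f dvd ?\<pi> H * r" for r
      by (rule dvd_prod_primes_mult_cancel[where J = "\<A> - {H}" and p = defining_form])
        (use A that ndvd in \<open>auto simp: arrangement_def prime_elem_defining_form defining_poly_def\<close>)
    have "f dvd ?\<pi> H * (?\<pi> H * 1)" using pi[OF H] by simp
    from *[OF *[OF this]] show ?thesis .
  qed
  then obtain g where g: "f * g = 1" by (auto simp: dvd_def)
  have "g *s u \<in> log_derivations \<A>"
    using D(1) by (rule der_module.subspace_scale[OF subspace_log_derivations])
  moreover have "det3 (g *s u) v w = defining_poly \<A>"
    using g by (simp add: det3_scale f mult.left_commute mult.commute)
  ultimately show ?thesis using that D by blast
qed

section \<open>Homogeneous bases\<close>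

definition hom_component :: "nat \<Rightarrow> ('k::comm_ring_1, 'n::finite) derivation \<Rightarrow> ('k, 'n) derivation" where
  "hom_component d \<theta> = (\<chi> l. coeff (grade (\<theta> $ l)) d)"

text \<open>The degree is that of the coefficients, so \<open>euler\<close> has degree 1.\<close>

definition hom_derivation :: "nat \<Rightarrow> ('k::comm_ring_1, 'n::finite) derivation \<Rightarrow> bool" where
  "hom_derivation d \<theta> \<longleftrightarrow> (\<forall>l. homogeneous d (\<theta> $ l))"

lemma hom_derivation_hom_component: "hom_derivation d (hom_component d \<theta>)"
  by (simp add: hom_derivation_def hom_component_def homogeneous_coeff_grade)

lemma contract_hom_component: "contract b (hom_component d \<theta>) = coeff (grade (contract b \<theta>)) d"
  by (simp add: contract_def hom_component_def grade.sum grade.mult coeff_sum)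

text \<open>A form of degree 1 only shifts the powers of t, so each coefficient keeps the
  factor.\<close>

lemma linear_form_dvd_coeff_grade:
  assumes "linear_form b dvd f"
  shows "linear_form b dvd coeff (grade f) d"
proof -
  obtain q where q: "f = linear_form b * q" using assms ..
  have "grade (linear_form b) = monom (linear_form b) 1"
    using homogeneous_linear_form(2)[of b] by (simp add: homogeneous_def)
  then show ?thesis by (simp add: q grade.mult coeff_monom_mult)
qed

lemma hom_component_log_derivation:
  "\<theta> \<in> log_derivations \<A> \<Longrightarrow> hom_component d \<theta> \<in> log_derivations \<A>"
  by (simp add: log_derivations_iff contract_hom_component defining_form_eq linear_form_dvd_coeff_grade)

lemma homogeneous_det3_euler:
  assumes "hom_derivation r x" "hom_derivation s y"
  shows "homogeneous (r + s + 1) (det3 euler x y)"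
proof -
  have "homogeneous (1 + (r + s)) (det3 euler x y)"
    using assms unfolding det3_def euler_def
    by (intro homogeneous_add homogeneous_mult homogeneous_diff) (simp_all add: hom_derivation_def)
  then show ?thesis by simp
qed

text \<open>The Euler row is homogeneous of degree 1, hence the shift between l + 1 and the two
  degrees adding up to l.\<close>

lemma coeff_grade_det3_euler:
  "coeff (grade (det3 euler x y)) 0 = 0"
  "coeff (grade (det3 euler x y)) (Suc l) =
     (\<Sum>r\<le>l. det3 euler (hom_component r x) (hom_component (l - r) y))"
  by (simp_all add: det3_def euler_def hom_component_def grade.hom_simps coeff_monom_mult)
    (simp add: coeff_mult sum.distrib sum_subtractf sum_distrib_left right_diff_distrib)

lemma det3_shift_euler:
  "det3 (f *s e + u) (g *s e + v) (h *s e + w) =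
     f * det3 e v w + g * det3 e w u + h * det3 e u v + det3 u v w"
  by (simp add: det3_def algebra_simps)

text \<open>\<open>euler\<close> maps the form of H to itself, so subtracting a suitable multiple of
  it makes the value at that form zero.\<close>

lemma exists_contract_zero_part:
  assumes \<theta>: "\<theta> \<in> log_derivations \<A>" and H: "H \<in> \<A>"
  shows "\<exists>g \<eta>. \<theta> = g *s euler + \<eta> \<and> \<eta> \<in> log_derivations \<A> \<and> contract (normal H) \<eta> = 0"
proof -
  obtain g where g: "contract (normal H) \<theta> = linear_form (normal H) * g"
    using \<theta> H by (auto simp: log_derivations_iff defining_form_eq dvd_def)
  have "\<theta> - g *s euler \<in> log_derivations \<A>"
    using \<theta> euler_log_derivation
    by (intro der_module.subspace_diff der_module.subspace_scale subspace_log_derivations)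
  moreover have "contract (normal H) (\<theta> - g *s euler) = 0"
    by (simp add: contract_diff contract_scale contract_euler g)
  ultimately show ?thesis by (intro exI[of _ g] exI[of _ "\<theta> - g *s euler"]) simp
qed

lemma free_arrangement_hom_basis:
  fixes \<A> :: "('k::field ^ 3) set set"
  assumes A: "arrangement \<A>" and H: "H \<in> \<A>" and free: "free_arrangement \<A>"
  obtains \<eta>1 \<eta>2 c d s where
    "\<eta>1 \<in> log_derivations \<A>" "\<eta>2 \<in> log_derivations \<A>"
    "contract (normal H) \<eta>1 = 0" "contract (normal H) \<eta>2 = 0"
    "hom_derivation c \<eta>1" "hom_derivation d \<eta>2" "c \<le> d" "c + d + 1 = card \<A>"
    "s \<noteq> 0" "det3 euler \<eta>1 \<eta>2 = Const s * defining_poly \<A>"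
proof -
  let ?Q = "defining_poly \<A>" and ?n = "card \<A>" and ?a = "normal H"
  have Q0: "?Q \<noteq> 0" by (rule defining_poly_nonzero[OF A])
  obtain u v w where D: "u \<in> log_derivations \<A>" "v \<in> log_derivations \<A>" "w \<in> log_derivations \<A>"
    and det: "det3 u v w = ?Q"
    using free_arrangement_det3[OF A _ free] H by blast
  obtain f u' where u: "u = f *s euler + u'" "u' \<in> log_derivations \<A>" "contract ?a u' = 0"
    using exists_contract_zero_part[OF D(1) H] by blast
  obtain g v' where v: "v = g *s euler + v'" "v' \<in> log_derivations \<A>" "contract ?a v' = 0"
    using exists_contract_zero_part[OF D(2) H] by blast
  obtain h w' where w: "w = h *s euler + w'" "w' \<in> log_derivations \<A>" "contract ?a w' = 0"
    using exists_contract_zero_part[OF D(3) H] by blast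
  obtain i j k where i: "?a $ i \<noteq> 0" and cyc: "cyclic i j k"
    using pivot_exists[of H] A H by (auto simp: arrangement_def)
  \<comment> \<open>Three derivations annihilating the form of H lie in a module of rank two, so
    only determinants with one Euler row survive in the expansion.\<close>
  have "det3 u' v' w' = 0"
    using det3_contract[OF cyc, of ?a u' v' w'] i by (simp add: u v w)
  then have Q_eq: "?Q = f * det3 euler v' w' + g * det3 euler w' u' + h * det3 euler u' v'"
    using det by (simp add: u(1) v(1) w(1) det3_shift_euler)
  let ?M = "{u', v', w'}"
  have dvd: "?Q dvd det3 euler (hom_component r x) (hom_component s y)"
    if "x \<in> ?M" "y \<in> ?M" for x y r s
    using that u v w
    by (intro defining_poly_dvd_det3[OF A] euler_log_derivation hom_component_log_derivation) auto
  have hom: "homogeneous (r + s + 1) (det3 euler (hom_component r x) (hom_component s y))"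
    for r s and x y :: "('k, 3) derivation"
    by (intro homogeneous_det3_euler hom_derivation_hom_component)
  have "\<exists>x\<in>?M. \<exists>y\<in>?M. \<exists>r s. r + s + 1 = ?n \<and> det3 euler (hom_component r x) (hom_component s y) \<noteq> 0"
  proof (rule ccontr)
    assume "\<not> ?thesis"
    then have eq0: "det3 euler (hom_component r x) (hom_component s y) = 0"
      if "r + s + 1 = ?n" "x \<in> ?M" "y \<in> ?M" for r s x y using that by blast
    \<comment> \<open>In degrees below \<open>?n\<close> a multiple of the defining polynomial can
      only be 0.\<close>
    have le0: "det3 euler (hom_component r x) (hom_component s y) = 0"
      if le: "r + s + 1 \<le> ?n" and x: "x \<in> ?M" and y: "y \<in> ?M" for r s x y
    proof (cases "r + s + 1 = ?n")
      case False
      with le have "\<not> ?n \<le> r + s + 1" by simp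
      then show ?thesis
        using homogeneous_dvd_cases(1)[OF hom homogeneous_defining_poly dvd[OF x y]] by blast
    qed (use eq0 x y in blast)
    have coeff0: "coeff (grade (det3 euler x y)) l = 0"
      if l: "l \<le> ?n" and x: "x \<in> ?M" and y: "y \<in> ?M" for l x y
    proof (cases l)
      case (Suc m)
      show ?thesis
        unfolding Suc coeff_grade_det3_euler(2)
        by (rule sum.neutral) (use le0 l x y Suc in simp)
    qed (simp add: coeff_grade_det3_euler(1))
    have "coeff (grade (q * det3 euler x y)) ?n = 0" if "x \<in> ?M" "y \<in> ?M" for q x y
      unfolding grade.mult coeff_mult by (rule sum.neutral) (use coeff0 that in simp)
    then have "coeff (grade ?Q) ?n = 0"
      by (subst Q_eq) (simp add: grade.add)
    moreover have "grade ?Q = monom ?Q ?n"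
      using homogeneous_defining_poly[of \<A>] by (simp add: homogeneous_def)
    ultimately show False using Q0 by simp
  qed
  then obtain x y r s where xy: "x \<in> ?M" "y \<in> ?M" and rs: "r + s + 1 = ?n"
    and nz: "det3 euler (hom_component r x) (hom_component s y) \<noteq> 0" by blast
  let ?x = "hom_component r x" and ?y = "hom_component s y"
  obtain c where c: "c \<noteq> 0" "det3 euler ?x ?y = Const c * ?Q"
    using homogeneous_dvd_cases(2)[OF hom homogeneous_defining_poly dvd[OF xy] nz] rs by auto
  have xyD: "?x \<in> log_derivations \<A>" "?y \<in> log_derivations \<A>"
    using xy u v w by (auto intro: hom_component_log_derivation)
  have xy0: "contract ?a ?x = 0" "contract ?a ?y = 0"
    using xy u v w by (auto simp: contract_hom_component grade.zero)
  show ?thesis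
  proof (cases "r \<le> s")
    case True
    show ?thesis
      by (rule that[OF xyD xy0 hom_derivation_hom_component hom_derivation_hom_component True rs c])
  next
    case False
    \<comment> \<open>Swapping the two derivations puts the smaller degree first, at the cost of a
      sign.\<close>
    have "det3 euler ?y ?x = Const (- c) * ?Q"
      using c(2) det3_swap[of euler ?y ?x] by (simp add: Const.uminus)
    then show ?thesis
      using that[OF xyD(2,1) xy0(2,1) hom_derivation_hom_component hom_derivation_hom_component, of "- c"]
        False rs c(1) by simp
  qed
qed

section \<open>Restriction to a hyperplane\<close>

text \<open>The cardinality of the restriction to H; it is applied to families without H, since H
  would count as a trace of itself.\<close>

definition num_restricted :: "'a set \<Rightarrow> 'a set set \<Rightarrow> nat" where
  "num_restricted H \<A> = card ((\<lambda>X. X \<inter> H) ` \<A>)"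

lemma num_restricted_mono: "finite \<A> \<Longrightarrow> \<B> \<subseteq> \<A> \<Longrightarrow> num_restricted H \<B> \<le> num_restricted H \<A>"
  unfolding num_restricted_def by (intro card_mono image_mono finite_imageI)

lemma restriction_representatives:
  obtains R where "R \<subseteq> \<A>" "inj_on (\<lambda>X. X \<inter> H) R" "(\<lambda>X. X \<inter> H) ` R = (\<lambda>X. X \<inter> H) ` \<A>"
    "card R = num_restricted H \<A>"
proof -
  obtain R where "R \<subseteq> \<A>" "inj_on (\<lambda>X. X \<inter> H) R" "(\<lambda>X. X \<inter> H) ` \<A> = (\<lambda>X. X \<inter> H) ` R"
    using subset_image_inj[of "(\<lambda>X. X \<inter> H) ` \<A>" "\<lambda>X. X \<inter> H" \<A>] by auto
  then show ?thesis using that card_image[of "\<lambda>X. X \<inter> H" R] by (simp add: num_restricted_def)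
qed

context
  fixes H :: "('k::field ^ 3) set" and i j k :: 3
  assumes H: "hyperplane H" and i: "normal H $ i \<noteq> 0" and cyc: "cyclic i j k"
begin

text \<open>Models restriction of polynomials to H, with the variables j and k as coordinates
  there.\<close>

abbreviation "restr \<equiv> eliminate i (normal H)"

abbreviation restricted_normal :: "('k ^ 3) set \<Rightarrow> 'k ^ 3" where
  "restricted_normal X \<equiv> reduce i (normal H) (normal X)"

lemma normal_decompose:
  "normal X = restricted_normal X + (normal X $ i / normal H $ i) *s normal H"
  by (simp add: reduce_def)

lemma restricted_normal_nonzero: "hyperplane X \<Longrightarrow> X \<noteq> H \<Longrightarrow> restricted_normal X \<noteq> 0"
  using normal_not_parallel[OF H, of X] by (auto simp: reduce_eq_0_iff[where i = i] i)

lemma prime_restricted: "hyperplane X \<Longrightarrow> X \<noteq> H \<Longrightarrow> prime_elem (linear_form (restricted_normal X))"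
  by (intro prime_elem_linear_form restricted_normal_nonzero)

lemma mem_restricted_iff:
  assumes "hyperplane X" "v \<in> H"
  shows "v \<in> X \<longleftrightarrow> (\<Sum>l\<in>UNIV. restricted_normal X $ l * v $ l) = 0"
proof -
  have "(\<Sum>l\<in>UNIV. normal X $ l * v $ l) = (\<Sum>l\<in>UNIV. restricted_normal X $ l * v $ l)
      + (normal X $ i / normal H $ i) * (\<Sum>l\<in>UNIV. normal H $ l * v $ l)"
    by (subst normal_decompose) (simp add: distrib_right sum.distrib sum_distrib_left mult.assoc)
  with assms show ?thesis by (simp add: mem_hyperplane_iff[OF H] mem_hyperplane_iff)
qed

lemma restricted_dvd_imp_eq:
  assumes X: "hyperplane X" "X \<noteq> H" and Y: "hyperplane Y" "Y \<noteq> H"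
    and dvd: "linear_form (restricted_normal X) dvd linear_form (restricted_normal Y)"
  shows "X \<inter> H = Y \<inter> H"
proof -
  obtain s where s: "restricted_normal Y = s *s restricted_normal X"
    using dvd restricted_normal_nonzero[OF X] by (auto simp: linear_form_dvd_linear_form_iff)
  with restricted_normal_nonzero[OF Y] have "s \<noteq> 0" by auto
  have "(\<Sum>l\<in>UNIV. restricted_normal Y $ l * v $ l) = s * (\<Sum>l\<in>UNIV. restricted_normal X $ l * v $ l)" for v
    by (simp add: s sum_distrib_left mult.assoc)
  with \<open>s \<noteq> 0\<close> have "v \<in> Y \<longleftrightarrow> v \<in> X" if "v \<in> H" for v
    using that X Y by (simp add: mem_restricted_iff)
  then show ?thesis by auto
qed

text \<open>An explicit vector on the line cut out by X and H also lies in Y; this forces the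
  restricted normals to be proportional, so X, Y and H belong to one pencil.\<close>

lemma restriction_eq_imp_normal:
  assumes X: "hyperplane X" "X \<noteq> H" and Y: "hyperplane Y" "Y \<noteq> H" and eq: "X \<inter> H = Y \<inter> H"
  obtains s t where "s \<noteq> 0" "normal Y = s *s normal X + t *s normal H"
proof -
  let ?a = "normal H" and ?x = "restricted_normal X" and ?y = "restricted_normal Y"
  \<comment> \<open>Coordinates j and k are orthogonal to the restricted normal of X, whose
    coordinate i is 0; coordinate i then solves the equation of H.\<close>
  define v :: "'k ^ 3" where "v = (\<chi> l. if l = j then ?x $ k else if l = k then - ?x $ j
    else - (?a $ j * ?x $ k - ?a $ k * ?x $ j) / ?a $ i)"
  have v: "v $ j = ?x $ k" "v $ k = - ?x $ j" "v $ i = - (?a $ j * ?x $ k - ?a $ k * ?x $ j) / ?a $ i"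
    using cyclic_distinct[OF cyc] by (simp_all add: v_def)
  have vH: "v \<in> H"
    using i by (simp add: mem_hyperplane_iff[OF H] sum_cyclic[OF cyc] v)
  have "v \<in> X"
    using i by (simp add: mem_restricted_iff[OF X(1) vH] sum_cyclic[OF cyc] v)
  with eq vH have "v \<in> Y" by blast
  then have par: "?y $ j * ?x $ k = ?y $ k * ?x $ j"
    using i by (simp add: mem_restricted_iff[OF Y(1) vH] sum_cyclic[OF cyc] v)
  have "\<exists>s. ?y = s *s ?x"
  proof (cases "?x $ j = 0")
    case False
    then show ?thesis
      using par i by (intro exI[of _ "?y $ j / ?x $ j"])
        (simp add: vec_eq_iff all_cyclic[OF cyc] field_simps)
  next
    case True
    have "?x $ k \<noteq> 0"
      using restricted_normal_nonzero[OF X] True i by (auto simp: vec_eq_iff all_cyclic[OF cyc])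
    then show ?thesis
      using par True i by (intro exI[of _ "?y $ k / ?x $ k"])
        (simp add: vec_eq_iff all_cyclic[OF cyc])
  qed
  then obtain s where s: "?y = s *s ?x" ..
  with restricted_normal_nonzero[OF Y] have "s \<noteq> 0" by auto
  moreover have "normal Y = s *s normal X + (normal Y $ i / ?a $ i - s * (normal X $ i / ?a $ i)) *s ?a"
    using normal_decompose[of Y] s by (simp add: reduce_def vec_eq_iff algebra_simps)
  ultimately show ?thesis by (rule that)
qed

text \<open>Serves to correct the second basis element by a multiple of the first, so that a
  polynomial attached to it vanishes on H.\<close>

lemma exists_eliminate_combination:
  assumes t: "t \<noteq> 0" and f: "restr f = Const t * p" and g: "p dvd restr g"
  shows "\<exists>q. restr (g - q * f) = 0"
proof -
  obtain r where r: "restr g = p * r" using g ..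
  \<comment> \<open>The factors p and r may still involve the variable i; applying
    \<open>restr\<close> once more replaces them by their restrictions.\<close>
  have "restr f = Const t * restr p"
    using arg_cong[OF f, of restr] by (simp add: eliminate_eliminate[OF i] eliminate.mult)
  moreover have "restr g = restr p * restr r"
    using arg_cong[OF r, of restr] by (simp add: eliminate_eliminate[OF i] eliminate.mult)
  moreover have "Const (1 / t) * (Const t * x) = x" for x :: "('k, 3) mpol"
    using t by (simp add: mult.assoc[symmetric] Const.mult[symmetric])
  ultimately have "restr (g - (Const (1 / t) * r) * f) = 0"
    by (simp add: eliminate.hom_simps mult_ac)
  then show ?thesis ..
qed

section \<open>Deletion\<close>

text \<open>The vanishing minor says that \<zeta> is parallel to \<open>euler\<close> along H, with
  a factor f. Then \<open>\<zeta> - f *s euler\<close> is divisible by the form of H, and the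
  quotient replaces \<zeta> in a basis for the smaller arrangement.\<close>

lemma free_deletion_if_eliminated:
  assumes A: "arrangement \<A>" and HA: "H \<in> \<A>"
    and D: "\<zeta> \<in> log_derivations \<A>" "\<omega> \<in> log_derivations \<A>" and \<zeta>0: "contract (normal H) \<zeta> = 0"
    and elim: "restr (Var j * \<zeta> $ k - Var k * \<zeta> $ j) = 0"
    and det: "det3 euler \<zeta> \<omega> = e * defining_poly \<A>" and e: "e dvd 1"
  shows "free_arrangement (\<A> - {H})"
proof -
  let ?a = "normal H"
  let ?h = "linear_form ?a"
  have A': "arrangement (\<A> - {H})" using A by (rule arrangement_subset) auto
  note ne = cyclic_distinct[OF cyc]
  have Var_lf: "Var l = linear_form (axis l 1 :: 'k ^ 3)" for l
  proof -
    have "Const ((axis l 1 :: 'k ^ 3) $ m) * Var m = (if m = l then Var m else 0)" for m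
      by (simp add: axis_def)
    then show ?thesis by (simp add: linear_form_conv)
  qed
  have ax: "(axis l 1 :: 'k ^ 3) \<noteq> 0" for l by (simp add: axis_eq_0_iff)
  have Var0: "Var l \<noteq> (0 :: ('k, 3) mpol)" for l
    by (simp only: Var_lf linear_form_eq_0_iff ax not_False_eq_True)
  have eq: "Var j * restr (\<zeta> $ k) = Var k * restr (\<zeta> $ j)"
    using elim ne by (simp add: eliminate.hom_simps)
  \<comment> \<open>The variables j and k are non-associated primes, so the proportionality on H
    yields a polynomial factor f.\<close>
  have "prime_elem (Var j :: ('k, 3) mpol)"
    unfolding Var_lf by (rule prime_elem_linear_form[OF ax])
  moreover have "\<not> Var j dvd (Var k :: ('k, 3) mpol)"
    unfolding Var_lf linear_form_dvd_linear_form_iff[OF ax] using ne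
    by (auto simp: vec_eq_iff all_cyclic[OF cyc] axis_def)
  moreover have "Var j dvd Var k * restr (\<zeta> $ j)" by (simp add: eq[symmetric])
  ultimately have "Var j dvd restr (\<zeta> $ j)" using prime_elem_dvd_multD by blast
  then obtain f where fj: "restr (\<zeta> $ j) = Var j * f" ..
  have "Var j * restr (\<zeta> $ k) = Var j * (Var k * f)" using eq fj by (simp add: mult_ac)
  then have fk: "restr (\<zeta> $ k) = Var k * f" using Var0 by simp
  have "restr (\<zeta> $ j) = Var j * restr f"
    using arg_cong[OF fj, of restr] ne by (simp add: eliminate_eliminate[OF i] eliminate.mult)
  then have "Var j * restr f = Var j * f" unfolding fj ..
  then have ff: "restr f = f" using Var0 by simp
  let ?\<xi> = "\<zeta> - f *s euler"
  have jk: "restr (?\<xi> $ j) = 0" "restr (?\<xi> $ k) = 0"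
    using ne by (simp_all add: eliminate.hom_simps fj fk ff euler_def mult.commute)
  \<comment> \<open>Coordinates j and k vanish on H; contraction with the normal vector forces
    coordinate i to vanish there too.\<close>
  have "contract ?a ?\<xi> = - f * ?h" by (simp add: contract_diff contract_scale contract_euler \<zeta>0)
  then have "restr (contract ?a ?\<xi>) = 0" by (simp add: eliminate.hom_simps eliminate_self[OF i])
  then have "Const (?a $ i) * restr (?\<xi> $ i) = 0"
    using jk unfolding contract_def sum_cyclic[OF cyc] eliminate.hom_simps by simp
  with jk i have "restr (?\<xi> $ l) = 0" for l
    using all_cyclic[OF cyc, of "\<lambda>l. restr (?\<xi> $ l) = 0"] by simp
  then have "\<forall>l. \<exists>q. ?\<xi> $ l = ?h * q" by (simp add: linear_form_dvd_iff[OF i, symmetric] dvd_def)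
  then obtain q where "\<forall>l. ?\<xi> $ l = ?h * q l" by metis
  then have \<xi>: "?\<xi> = ?h *s (\<chi> l. q l)" by (simp add: vec_eq_iff)
  let ?\<zeta>' = "\<chi> l. q l"
  have "?\<xi> \<in> log_derivations \<A>"
    using D(1) euler_log_derivation
    by (intro der_module.subspace_diff der_module.subspace_scale subspace_log_derivations)
  have \<zeta>': "?\<zeta>' \<in> log_derivations (\<A> - {H})"
    unfolding log_derivations_iff
  proof
    fix X assume X: "X \<in> \<A> - {H}"
    then have hX: "hyperplane X" "X \<noteq> H" using A by (auto simp: arrangement_def)
    have "defining_form X dvd contract (normal X) ?\<xi>"
      using \<open>?\<xi> \<in> log_derivations \<A>\<close> X unfolding log_derivations_iff by blast
    then have "defining_form X dvd defining_form H * contract (normal X) ?\<zeta>'"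
      unfolding \<xi> contract_scale defining_form_eq[of H] .
    then show "defining_form X dvd contract (normal X) ?\<zeta>'"
      using prime_elem_defining_form[OF hX(1)] defining_form_not_dvd[OF hX(1) H hX(2)]
      by (blast dest: prime_elem_dvd_multD)
  qed
  have "det3 euler \<zeta> \<omega> = det3 euler ?\<xi> \<omega>" by (simp add: det3_def algebra_simps)
  also have "\<dots> = ?h * det3 euler ?\<zeta>' \<omega>"
    unfolding \<xi> by (simp add: det3_def algebra_simps)
  finally have "?h * det3 euler ?\<zeta>' \<omega> = e * defining_poly \<A>" using det by simp
  also have "defining_poly \<A> = ?h * defining_poly (\<A> - {H})"
    using defining_poly_insert[OF A', of H] HA by (simp add: insert_absorb defining_form_eq)
  finally have "?h * det3 euler ?\<zeta>' \<omega> = ?h * (e * defining_poly (\<A> - {H}))"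
    by (simp only: mult.left_commute)
  then have "det3 euler ?\<zeta>' \<omega> = e * defining_poly (\<A> - {H})"
    using normal_nonzero[OF H] by simp
  moreover have "\<omega> \<in> log_derivations (\<A> - {H})" using D(2) by (simp add: log_derivations_iff)
  ultimately show ?thesis
    using free_arrangement_if_det3[OF A' euler_log_derivation \<zeta>' _ _ e] by blast
qed

text \<open>Modulo the restricted form of X, its coefficient vector annihilates both the variables
  j, k and the coordinates j, k of \<eta> on H. Multiplying the minor by a nonzero coefficient of
  the form exhibits the divisibility.\<close>

lemma restricted_dvd_minor:
  assumes \<eta>: "\<eta> \<in> log_derivations \<A>" "contract (normal H) \<eta> = 0"
    and X: "X \<in> \<A>" "hyperplane X" "X \<noteq> H"
  shows "linear_form (restricted_normal X) dvd restr (Var j * \<eta> $ k - Var k * \<eta> $ j)"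
proof -
  let ?r = "restricted_normal X"
  note ne = cyclic_distinct[OF cyc]
  have "contract (normal X) \<eta> = contract ?r \<eta>"
    by (subst normal_decompose) (simp add: contract_add_left contract_scale_left \<eta>(2))
  then have "linear_form (normal X) dvd contract ?r \<eta>"
    using \<eta>(1) X(1) by (auto simp: log_derivations_iff defining_form_eq)
  from eliminate.dvd[OF this, of i "normal H"]
  have z: "linear_form ?r dvd Const (?r $ j) * restr (\<eta> $ j) + Const (?r $ k) * restr (\<eta> $ k)" (is "_ dvd ?z")
    using i by (simp add: eliminate_linear_form contract_def sum_cyclic[OF cyc] eliminate.hom_simps)
  have r: "linear_form ?r = Const (?r $ j) * Var j + Const (?r $ k) * Var k"
    using i by (simp add: linear_form_conv sum_cyclic[OF cyc])
  let ?w = "restr (Var j * \<eta> $ k - Var k * \<eta> $ j)"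
  have w: "?w = Var j * restr (\<eta> $ k) - Var k * restr (\<eta> $ j)"
    using ne by (simp add: eliminate.hom_simps)
  have "Const (?r $ j) * ?w = linear_form ?r * restr (\<eta> $ k) - Var k * ?z"
    by (simp add: w r algebra_simps)
  then have wj: "linear_form ?r dvd Const (?r $ j) * ?w" using z by simp
  have "Const (?r $ k) * ?w = Var j * ?z - linear_form ?r * restr (\<eta> $ j)"
    by (simp add: w r algebra_simps)
  then have wk: "linear_form ?r dvd Const (?r $ k) * ?w" using z by simp
  have "?r $ j \<noteq> 0 \<or> ?r $ k \<noteq> 0"
    using restricted_normal_nonzero[OF X(2,3)] i by (auto simp: vec_eq_iff all_cyclic[OF cyc])
  then show ?thesis using wj wk dvd_unit_mult_cancel[OF is_unit_Const] by blast
qed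

text \<open>On H the minor that measures deviation from \<open>euler\<close> is a multiple of
  \<open>P\<close>, which has one linear form per trace. For \<eta>1 its degree c + 1 is at most
  that of \<open>P\<close>, so it is 0 or a constant multiple of \<open>P\<close>; in the second
  case a multiple of \<eta>1 clears the minor of \<eta>2.\<close>

lemma free_deletion:
  assumes A: "arrangement \<A>" and HA: "H \<in> \<A>"
    and D: "\<eta>1 \<in> log_derivations \<A>" "\<eta>2 \<in> log_derivations \<A>"
    and \<eta>0: "contract (normal H) \<eta>1 = 0" "contract (normal H) \<eta>2 = 0"
    and hom: "hom_derivation c \<eta>1" and num: "c < num_restricted H (\<A> - {H})"
    and s: "s \<noteq> 0" and det: "det3 euler \<eta>1 \<eta>2 = Const s * defining_poly \<A>"
  shows "free_arrangement (\<A> - {H})"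
proof -
  obtain R where R: "R \<subseteq> \<A> - {H}" "inj_on (\<lambda>X. X \<inter> H) R" "card R = num_restricted H (\<A> - {H})"
    using restriction_representatives[of "\<A> - {H}" H] by metis
  have R_hyp: "hyperplane X" "X \<noteq> H" "X \<in> \<A>" if "X \<in> R" for X
    using that R(1) A by (auto simp: arrangement_def)
  define P where "P = (\<Prod>X\<in>R. linear_form (restricted_normal X))"
  let ?w = "\<lambda>\<eta> :: ('k, 3) derivation. Var j * \<eta> $ k - Var k * \<eta> $ j"
  have P_dvd: "P dvd restr (?w \<eta>)" if "\<eta> \<in> log_derivations \<A>" "contract (normal H) \<eta> = 0" for \<eta>
    unfolding P_def
  proof (rule prod_primes_dvd)
    show "finite R" using R(1) A by (auto simp: arrangement_def intro: finite_subset)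
    show "prime_elem (linear_form (restricted_normal X))" if "X \<in> R" for X
      using R_hyp[OF that] by (intro prime_restricted)
    show "\<not> linear_form (restricted_normal X) dvd linear_form (restricted_normal Y)"
      if X: "X \<in> R" and Y: "Y \<in> R" and "X \<noteq> Y" for X Y
    proof
      assume "linear_form (restricted_normal X) dvd linear_form (restricted_normal Y)"
      then have "X \<inter> H = Y \<inter> H"
        by (rule restricted_dvd_imp_eq[OF R_hyp(1,2)[OF X] R_hyp(1,2)[OF Y]])
      then have "X = Y" by (rule inj_onD[OF R(2) _ X Y])
      with \<open>X \<noteq> Y\<close> show False ..
    qed
    show "linear_form (restricted_normal X) dvd restr (?w \<eta>)" if "X \<in> R" for X
      by (rule restricted_dvd_minor[OF \<open>\<eta> \<in> log_derivations \<A>\<close>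
            \<open>contract (normal H) \<eta> = 0\<close> R_hyp(3,1,2)[OF that]])
  qed
  have hom_P: "homogeneous (card R) P"
    using homogeneous_prod[of R "\<lambda>_. 1" "\<lambda>X. linear_form (restricted_normal X)"] by (simp add: P_def)
  have "homogeneous (1 + c) (?w \<eta>1)"
    using hom by (intro homogeneous_diff homogeneous_mult) (simp_all add: hom_derivation_def)
  then have hom_w: "homogeneous (1 + c) (restr (?w \<eta>1))" by (rule homogeneous_eliminate)
  show ?thesis
  proof (cases "restr (?w \<eta>1) = 0")
    case True
    then show ?thesis
      using free_deletion_if_eliminated[OF A HA D \<eta>0(1) _ det] is_unit_Const[OF s] by blast
  next
    case False
    obtain t where t: "t \<noteq> 0" "restr (?w \<eta>1) = Const t * P"
      using homogeneous_dvd_cases(2)[OF hom_w hom_P P_dvd[OF D(1) \<eta>0(1)] False] num R(3) by auto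
    obtain q where q: "restr (?w \<eta>2 - q * ?w \<eta>1) = 0"
      using exists_eliminate_combination[OF t P_dvd[OF D(2) \<eta>0(2)]] by blast
    let ?\<zeta> = "\<eta>2 - q *s \<eta>1"
    have "?w ?\<zeta> = ?w \<eta>2 - q * ?w \<eta>1" by (simp add: algebra_simps)
    with q have "restr (?w ?\<zeta>) = 0" by simp
    moreover have "?\<zeta> \<in> log_derivations \<A>"
      using D by (intro der_module.subspace_diff der_module.subspace_scale subspace_log_derivations)
    moreover have "contract (normal H) ?\<zeta> = 0" by (simp add: contract_diff contract_scale \<eta>0)
    moreover have "det3 euler ?\<zeta> \<eta>1 = - det3 euler \<eta>1 \<eta>2" by (simp add: det3_def algebra_simps)
    then have "det3 euler ?\<zeta> \<eta>1 = Const (- s) * defining_poly \<A>" by (simp add: det Const.uminus)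
    moreover have "Const (- s) dvd (1 :: ('k, 3) mpol)" using s by (intro is_unit_Const) simp
    ultimately show ?thesis using free_deletion_if_eliminated[OF A HA _ D(1)] by blast
  qed
qed

section \<open>Addition\<close>

text \<open>The elimination hypothesis puts \<zeta> into the module of the larger arrangement;
  \<omega> enters it after multiplication by the form of H, which also supplies the missing factor
  of the determinant.\<close>

lemma free_addition_if_eliminated:
  assumes B: "arrangement \<B>" and HB: "H \<notin> \<B>"
    and D: "\<zeta> \<in> log_derivations \<B>" "\<omega> \<in> log_derivations \<B>"
    and elim: "restr (contract (normal H) \<zeta>) = 0"
    and det: "det3 euler \<zeta> \<omega> = e * defining_poly \<B>" and e: "e dvd 1"
  shows "free_arrangement (insert H \<B>)"
proof (rule free_arrangement_if_det3[OF _ euler_log_derivation _ _ _ e])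
  show "arrangement (insert H \<B>)" using B H by (simp add: arrangement_def)
  show "\<zeta> \<in> log_derivations (insert H \<B>)"
    using D(1) elim by (auto simp: log_derivations_iff defining_form_eq linear_form_dvd_iff[OF i])
  show "defining_form H *s \<omega> \<in> log_derivations (insert H \<B>)"
    using D(2) by (auto simp: log_derivations_iff contract_scale)
  show "det3 euler \<zeta> (defining_form H *s \<omega>) = e * defining_poly (insert H \<B>)"
  proof -
    have "det3 euler \<zeta> (defining_form H *s \<omega>) = defining_form H * det3 euler \<zeta> \<omega>"
      by (simp add: det3_def algebra_simps)
    then show ?thesis by (simp add: det defining_poly_insert[OF B HB] mult_ac)
  qed
qed

text \<open>
  Along the intersection of \<open>H\<close> with a fixed \<open>Y\<close>, the polynomial
  \<open>\<alpha>\<^sub>H \<theta>(\<alpha>\<^sub>Y) - \<alpha>\<^sub>Y \<theta>(\<alpha>\<^sub>H)\<close> is divisible by the forms of all members of the pencil.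
\<close>

lemma prod_pencil_dvd:
  assumes B: "arrangement \<B>" and HB: "H \<notin> \<B>" and \<theta>: "\<theta> \<in> log_derivations \<B>" and Y: "Y \<in> \<B>"
  shows "(\<Prod>X\<in>{X\<in>\<B>. X \<inter> H = Y \<inter> H}. linear_form (restricted_normal X)) dvd
    linear_form (restricted_normal Y) * restr (contract (normal H) \<theta>)"
proof -
  let ?G = "{X\<in>\<B>. X \<inter> H = Y \<inter> H}" and ?a = "normal H"
  let ?w = "linear_form ?a * contract (normal Y) \<theta> - linear_form (normal Y) * contract ?a \<theta>"
  have hyp: "hyperplane X" "X \<noteq> H" if "X \<in> \<B>" for X using B HB that by (auto simp: arrangement_def)
  have "defining_poly ?G dvd ?w"
  proof (rule defining_poly_dvd)
    show "arrangement ?G" using B by (rule arrangement_subset) auto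
    fix X assume X: "X \<in> ?G"
    then have XB: "X \<in> \<B>" and XY: "Y \<inter> H = X \<inter> H" by auto
    obtain s t where s: "s \<noteq> 0" and st: "normal X = s *s normal Y + t *s ?a"
      using restriction_eq_imp_normal[OF hyp[OF Y] hyp[OF XB] XY] .
    \<comment> \<open>The expression is alternating in the pair H, Y, so replacing the normal of Y
      by that of X in the pencil only multiplies it by s.\<close>
    have "Const s * ?w = linear_form ?a * contract (normal X) \<theta> - linear_form (normal X) * contract ?a \<theta>"
      unfolding st
      by (simp add: contract_add_left contract_scale_left linear_form_add linear_form_scale algebra_simps)
    also have "defining_form X dvd \<dots>"
      using \<theta> XB by (auto simp: log_derivations_iff defining_form_eq)
    finally show "defining_form X dvd ?w" by (rule dvd_unit_mult_cancel[OF is_unit_Const[OF s]])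
  qed
  \<comment> \<open>Restriction to H kills the first summand of \<open>?w\<close>.\<close>
  from eliminate.dvd[OF this, of i ?a]
  have "restr (defining_poly ?G) dvd - (linear_form (restricted_normal Y) * restr (contract ?a \<theta>))"
    by (simp add: eliminate.diff eliminate.mult eliminate_self[OF i] eliminate_linear_form[of i ?a "normal Y"])
  then show ?thesis
    by (simp add: defining_poly_def eliminate.prod defining_form_eq eliminate_linear_form)
qed

text \<open>\<open>T\<close> has degree \<open>card \<B> - num_restricted H \<B>\<close> and
  divides, on H, the value of every logarithmic derivation at the form of H. By the bound on c this
  value is 0 or a constant multiple of \<open>T\<close> for \<eta>1; in the second case a multiple
  of \<eta>1 corrects \<eta>2.\<close>

lemma free_addition:
  assumes B: "arrangement \<B>" and HB: "H \<notin> \<B>"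
    and D: "\<eta>1 \<in> log_derivations \<B>" "\<eta>2 \<in> log_derivations \<B>"
    and hom: "hom_derivation c \<eta>1" and num: "num_restricted H \<B> + c \<le> card \<B>"
    and s: "s \<noteq> 0" and det: "det3 euler \<eta>1 \<eta>2 = Const s * defining_poly \<B>"
  shows "free_arrangement (insert H \<B>)"
proof -
  let ?a = "normal H" and ?l = "\<lambda>X. linear_form (restricted_normal X)"
  obtain R where R: "R \<subseteq> \<B>" "(\<lambda>X. X \<inter> H) ` R = (\<lambda>X. X \<inter> H) ` \<B>" "card R = num_restricted H \<B>"
    using restriction_representatives[of \<B> H] by metis
  have hyp: "hyperplane X" "X \<noteq> H" if "X \<in> \<B>" for X using B HB that by (auto simp: arrangement_def)
  have fin: "finite \<B>" "finite R" using B R(1) by (auto simp: arrangement_def intro: finite_subset)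
  define T where "T = prod ?l (\<B> - R)"
  have split: "prod ?l \<B> = prod ?l R * T"
    unfolding T_def using prod.subset_diff[OF R(1) fin(1), of ?l] by (simp add: mult.commute)
  have R0: "prod ?l R \<noteq> 0"
    using fin R(1) hyp restricted_normal_nonzero by auto
  have T_dvd: "T dvd restr (contract ?a \<theta>)" if \<theta>: "\<theta> \<in> log_derivations \<B>" for \<theta>
  proof -
    \<comment> \<open>Each pencil loses one factor, that of its representative in \<open>R\<close>;
      cancelling the product over \<open>R\<close> leaves \<open>T\<close>.\<close>
    have "prod ?l \<B> dvd prod ?l R * restr (contract ?a \<theta>)"
    proof (rule prod_primes_dvd_if_classes_dvd[where \<kappa> = "\<lambda>X. X \<inter> H"])
      fix X assume "X \<in> \<B>"
      then have "X \<inter> H \<in> (\<lambda>X. X \<inter> H) ` R" unfolding R(2) by blast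
      then obtain Y where Y: "Y \<in> R" "X \<inter> H = Y \<inter> H" by blast
      have "prod ?l {Z\<in>\<B>. Z \<inter> H = X \<inter> H} dvd ?l Y * restr (contract ?a \<theta>)"
        unfolding Y(2) using prod_pencil_dvd[OF B HB \<theta>, of Y] Y R(1) by blast
      also have "\<dots> dvd prod ?l R * restr (contract ?a \<theta>)"
        using Y fin by (intro mult_dvd_mono dvd_prodI) auto
      finally show "prod ?l {Z\<in>\<B>. Z \<inter> H = X \<inter> H} dvd prod ?l R * restr (contract ?a \<theta>)" .
    next
      fix X Y assume "X \<in> \<B>" "Y \<in> \<B>" "X \<inter> H \<noteq> Y \<inter> H"
      then show "\<not> ?l X dvd ?l Y" using restricted_dvd_imp_eq[of X Y] hyp by blast
    qed (use fin hyp prime_restricted in blast)+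
    then show ?thesis using R0 by (simp add: split)
  qed
  have "card (\<B> - R) = card \<B> - card R" using R(1) fin by (simp add: card_Diff_subset)
  then have card_T: "c \<le> card (\<B> - R)" using num R(3) by simp
  have hom_T: "homogeneous (card (\<B> - R)) T"
    using homogeneous_prod[of "\<B> - R" "\<lambda>_. 1" ?l] by (simp add: T_def)
  have "homogeneous c (contract ?a \<eta>1)"
    unfolding contract_def using hom
    by (intro homogeneous_sum homogeneous_Const_mult) (simp add: hom_derivation_def)
  then have hom_\<eta>: "homogeneous c (restr (contract ?a \<eta>1))" by (rule homogeneous_eliminate)
  show ?thesis
  proof (cases "restr (contract ?a \<eta>1) = 0")
    case True
    then show ?thesis
      using free_addition_if_eliminated[OF B HB D _ det is_unit_Const[OF s]] by blast
  next
    case False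
    obtain t where t: "t \<noteq> 0" "restr (contract ?a \<eta>1) = Const t * T"
      using homogeneous_dvd_cases(2)[OF hom_\<eta> hom_T T_dvd[OF D(1)] False card_T] by blast
    obtain q where q: "restr (contract ?a \<eta>2 - q * contract ?a \<eta>1) = 0"
      using exists_eliminate_combination[OF t T_dvd[OF D(2)]] by blast
    let ?\<zeta> = "\<eta>2 - q *s \<eta>1"
    have "restr (contract ?a ?\<zeta>) = 0" using q by (simp add: contract_diff contract_scale)
    moreover have "?\<zeta> \<in> log_derivations \<B>"
      using D by (intro der_module.subspace_diff der_module.subspace_scale subspace_log_derivations)
    moreover have "det3 euler ?\<zeta> \<eta>1 = - det3 euler \<eta>1 \<eta>2" by (simp add: det3_def algebra_simps)
    then have "det3 euler ?\<zeta> \<eta>1 = Const (- s) * defining_poly \<B>" by (simp add: det Const.uminus)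
    moreover have "Const (- s) dvd (1 :: ('k, 3) mpol)" using s by (intro is_unit_Const) simp
    ultimately show ?thesis using free_addition_if_eliminated[OF B HB _ D(1)] by blast
  qed
qed

end

section \<open>Free paths\<close>

lemma free_deletion_or_addition:
  fixes \<A> \<B> :: "('k::field ^ 3) set set"
  assumes A: "arrangement \<A>" "free_arrangement \<A>" and B: "\<B> \<subseteq> \<A>" "free_arrangement \<B>"
    and card: "card \<A> \<le> card \<B> + 3" and H: "H \<in> \<A>" "H \<notin> \<B>"
  shows "free_arrangement (\<A> - {H}) \<or> free_arrangement (insert H \<B>)"
proof (cases "\<B> = {}")
  \<comment> \<open>The homogeneous basis requires a nonempty arrangement; here adding H gives a
    single hyperplane.\<close>
  case True
  then show ?thesis using A H by (simp add: arrangement_def free_arrangement_singleton)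
next
  case False
  then obtain X where X: "X \<in> \<B>" by auto
  have arrB: "arrangement \<B>" using A(1) B(1) by (rule arrangement_subset)
  have hyp: "hyperplane H" using A H by (simp add: arrangement_def)
  obtain i j k where piv: "normal H $ i \<noteq> 0" "cyclic i j k" using pivot_exists[OF hyp] .
  obtain \<eta>1 \<eta>2 a b s where \<eta>: "\<eta>1 \<in> log_derivations \<A>" "\<eta>2 \<in> log_derivations \<A>"
    "contract (normal H) \<eta>1 = 0" "contract (normal H) \<eta>2 = 0" "hom_derivation a \<eta>1"
    and ab: "a \<le> b" "a + b + 1 = card \<A>"
    and s: "s \<noteq> 0" "det3 euler \<eta>1 \<eta>2 = Const s * defining_poly \<A>"
    using free_arrangement_hom_basis[OF A(1) H(1) A(2)] by metis
  \<comment> \<open>Since H is not in \<B>, the homogeneous basis is taken relative to another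
    member X of \<B>.\<close>
  obtain \<xi>1 \<xi>2 c d t where \<xi>: "\<xi>1 \<in> log_derivations \<B>" "\<xi>2 \<in> log_derivations \<B>" "hom_derivation c \<xi>1"
    and cd: "c \<le> d" "c + d + 1 = card \<B>"
    and t: "t \<noteq> 0" "det3 euler \<xi>1 \<xi>2 = Const t * defining_poly \<B>"
    using free_arrangement_hom_basis[OF arrB X B(2)] by metis
  show ?thesis
  proof (rule ccontr)
    assume neg: "\<not> ?thesis"
    have "\<not> a < num_restricted H (\<A> - {H})"
      using neg free_deletion[OF hyp piv A(1) H(1) \<eta> _ s] by blast
    moreover have "\<not> num_restricted H \<B> + c \<le> card \<B>"
      using neg free_addition[OF hyp piv arrB H(2) \<xi> _ t] by blast
    moreover have "num_restricted H \<B> \<le> num_restricted H (\<A> - {H})"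
      using A(1) B(1) H(2) by (intro num_restricted_mono) (auto simp: arrangement_def)
    \<comment> \<open>The failures give a \<ge> d + 2, so \<open>card \<A>\<close> = a + b + 1 \<ge>
      2d + 5 \<ge> c + d + 5 = \<open>card \<B>\<close> + 4.\<close>
    ultimately show False using ab cd card by linarith
  qed
qed

lemma free_path_of_length_3:
  assumes free: "free_arrangement \<B>" "free_arrangement (insert X \<B>)"
    "free_arrangement (insert Y (insert X \<B>))" "free_arrangement (insert Z (insert Y (insert X \<B>)))"
    and new: "X \<notin> \<B>" "Y \<notin> insert X \<B>" "Z \<notin> insert Y (insert X \<B>)"
  shows "\<exists>\<C> :: nat \<Rightarrow> ('k::field ^ 3) set set.
           \<C> 0 = \<B> \<and> \<C> 3 = insert Z (insert Y (insert X \<B>)) \<and>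
           (\<forall>i\<in>{1..3}. \<C> (i - 1) \<subset> \<C> i \<and> card (\<C> i - \<C> (i - 1)) = 1) \<and>
           (\<forall>i\<in>{0..3}. free_arrangement (\<C> i))"
proof -
  define \<C> where "\<C> = (\<lambda>n::nat. if n = 0 then \<B> else if n = 1 then insert X \<B>
    else if n = 2 then insert Y (insert X \<B>) else insert Z (insert Y (insert X \<B>)))"
  have C: "\<C> 0 = \<B>" "\<C> 1 = insert X \<B>" "\<C> 2 = insert Y (insert X \<B>)"
    "\<C> 3 = insert Z (insert Y (insert X \<B>))"
    by (simp_all add: \<C>_def)
  have step: "\<B>' \<subset> insert V \<B>' \<and> card (insert V \<B>' - \<B>') = 1" if "V \<notin> \<B>'"
    for V :: "('k ^ 3) set" and \<B>'
    using that by (auto simp: insert_Diff_if)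
  have "{1..3} = {1, 2, 3::nat}" "{0..3} = {0, 1, 2, 3::nat}" by auto
  moreover have "(2::nat) - 1 = 1" "(3::nat) - 1 = 2" by simp_all
  ultimately show ?thesis
    using free step[OF new(1)] step[OF new(2)] step[OF new(3)]
    by (intro exI[of _ \<C>]) (simp only: C ball_simps, simp add: C)
qed

theorem theorem1p3:
  fixes \<A> \<B> :: "('k::field ^ 3) set set" and H1 H2 H3 :: "('k ^ 3) set"
  assumes "arrangement \<A>" and "essential \<A>" and "free_arrangement \<A>"
    and "H1 \<in> \<A>" and "H2 \<in> \<A>" and "H3 \<in> \<A>"
    and "H1 \<noteq> H2" and "H1 \<noteq> H3" and "H2 \<noteq> H3"
    and "\<B> = \<A> - {H1, H2, H3}"
    and "free_arrangement \<B>"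
  shows "\<exists>\<C> :: nat \<Rightarrow> ('k ^ 3) set set.
           \<C> 0 = \<B> \<and> \<C> 3 = \<A> \<and>
           (\<forall>i\<in>{1..3}. \<C> (i - 1) \<subset> \<C> i \<and> card (\<C> i - \<C> (i - 1)) = 1) \<and>
           (\<forall>i\<in>{0..3}. free_arrangement (\<C> i))"
proof -
  let ?free = free_arrangement
  have new: "H1 \<notin> \<B>" "H2 \<notin> \<B>" "H3 \<notin> \<B>" using assms by auto
  have A_eq: "\<A> = {H1, H2, H3} \<union> \<B>" using assms by auto
  have fin: "finite \<B>" using assms by (auto simp: arrangement_def)
  have neq: "H2 \<noteq> H1" "H3 \<noteq> H1" "H3 \<noteq> H2" using assms by auto
  note dist = assms(7-9) neq new
  \<comment> \<open>Hyperplanes are added in the order X, Y, Z, so only the two intermediate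
    arrangements must be shown free.\<close>
  have path: ?thesis
    if "?free (insert X \<B>)" "?free (insert Y (insert X \<B>))" "distinct [X, Y, Z]" "{X, Y, Z} = {H1, H2, H3}"
    for X Y Z
  proof -
    have eq: "insert Z (insert Y (insert X \<B>)) = \<A>" using that(4) A_eq by auto
    have "V \<notin> \<B>" if "V \<in> {X, Y, Z}" for V
      using that new unfolding \<open>{X, Y, Z} = {H1, H2, H3}\<close> by blast
    then have "X \<notin> \<B>" "Y \<notin> insert X \<B>" "Z \<notin> insert Y (insert X \<B>)"
      using that(3) by auto
    from free_path_of_length_3[OF assms(11) that(1,2) _ this] assms(3)
    show ?thesis unfolding eq by blast
  qed
  have arr: "arrangement (\<A> - {H1})" using assms(1) by (rule arrangement_subset) auto
  have A1: "\<A> - {H1} = insert H3 (insert H2 \<B>)" and A12: "\<A> - {H1} - {H2} = insert H3 \<B>"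
    and A2: "\<A> - {H2} = insert H3 (insert H1 \<B>)"
    using A_eq dist by auto
  have cards: "card \<A> = card \<B> + 3" "card (\<A> - {H1}) = card \<B> + 2" "card (insert H1 \<B>) = card \<B> + 1"
    using fin dist by (simp_all add: A_eq insert_Diff_if)
  have "?free (\<A> - {H1}) \<or> ?free (insert H1 \<B>)"
    by (rule free_deletion_or_addition) (use assms new cards in auto)
  then show ?thesis
  proof
    assume del: "?free (\<A> - {H1})"
    \<comment> \<open>H1 is now added last. The dichotomy for H2 makes it either the second or the
      first to be added.\<close>
    have "?free (\<A> - {H1} - {H2}) \<or> ?free (insert H2 \<B>)"
      by (rule free_deletion_or_addition[OF arr del]) (use assms new cards in auto)
    then show ?thesis
    proof
      assume "?free (\<A> - {H1} - {H2})"
      then show ?thesis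
        using del dist by (intro path[of H3 H2 H1]) (auto simp: A1 A12 insert_commute)
    next
      assume "?free (insert H2 \<B>)"
      then show ?thesis
        using del dist by (intro path[of H2 H3 H1]) (auto simp: A1)
    qed
  next
    assume add: "?free (insert H1 \<B>)"
    \<comment> \<open>H1 is now added first. The dichotomy for H2 makes it either the last or the
      second to be added.\<close>
    have "?free (\<A> - {H2}) \<or> ?free (insert H2 (insert H1 \<B>))"
      by (rule free_deletion_or_addition[OF assms(1,3) _ add]) (use assms new cards in auto)
    then show ?thesis
    proof
      assume "?free (\<A> - {H2})"
      then show ?thesis
        using add dist by (intro path[of H1 H3 H2]) (auto simp: A2)
    next
      assume "?free (insert H2 (insert H1 \<B>))"
      then show ?thesis
        using add dist by (intro path[of H1 H2 H3]) auto
    qed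
  qed
qed

end
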